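(* Work in two space dimensions, with $M\ge 0$, a kernel $\mathsf J=\mathsf J_c-\mathsf J_e$ and constants $\gamma_c,\gamma_e\ge 0$ satisfying the assumptions (A1)–(A3) and $\gamma_0>0$ stated in the context. Let smooth, $\Omega$-periodic initial data $\Phi(\cdot,\cdot,0)$ be given, and suppose that $\Phi(x_1,x_2,t)$ is the unique, smooth, $\Omega$-periodic solution on $\Omega$ for $0\le t\le T$, for some $T<\infty$, of the nonlocal Allen–Cahn equation $$\partial_t\Phi=-M\big(\Phi^3+\gamma_c\Phi-\gamma_e\Phi+(\mathsf J*1)\Phi-\mathsf J*\Phi\big).$$ Set $\Phi^k_{i,j}:=\Phi(p_i,p_j,ks)$. Let $\phi^k\in\mathcal C_{m\times n}$ be the $k$-th periodic solution of the fully discrete nAC scheme defined in the context with time step $s$, grid size $h$ and starting value $\phi^0_{i,j}:=\Phi^0_{i,j}$. Put $e^k_{i,j}:=\Phi^k_{i,j}-\phi^k_{i,j}$. Let $C_*>0$ be any fixed constant. Then there exist $s_0,h_0>0$ and a constant $C>0$, with $C$ independent of $h$ and $s$, such that whenever $0<s\le s_0$, $0<h\le h_0$ and $s\le C_* h$, $$\|e^l\|_\infty\le C\,(h^2+s^2)$$ for all positive integers $l$ such that $l\,s\le T$.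
   Context: Continuous setting: $\Omega=(0,L_1)\times(0,L_2)$; $C^\infty_{\rm per}(\Omega)$ is the set of smooth $\Omega$-periodic functions on $\mathbb R^2$. The kernel is $\mathsf J=\mathsf J_c-\mathsf J_e$ where: (A1) $\mathsf J_c,\mathsf J_e\in C^\infty_{\rm per}(\Omega)$ are non-negative; (A2) $\mathsf J_c,\mathsf J_e$ are even, $\mathsf J_\alpha(-x_1,-x_2)=\mathsf J_\alpha(x_1,x_2)$; (A3) $\int_\Omega\mathsf J\,d\mathbf x>0$. Periodic convolution: $(\mathsf J*\phi)(\mathbf x)=\int_\Omega\mathsf J(\mathbf y)\phi(\mathbf x-\mathbf y)\,d\mathbf y$; in particular $\mathsf J*1=\int_\Omega \mathsf J\,d\mathbf x$. Constants $\gamma_c,\gamma_e\ge0$ satisfy $\gamma_0:=\gamma_c-\gamma_e+\mathsf J*1>0$. Grid: $h>0$ with $L_1=m h$, $L_2=n h$, $m,n$ positive integers; $p_r:=(r-\tfrac12)h$ for integer or half-integer $r$. $\mathcal C_{m\times n}$ is the space of cell-centered grid functions $\phi_{i,j}=\phi(p_i,p_j)$, $1\le i\le m$, $1\le j\le n$; periodic ones are extended by $\phi_{i+am,j+bn}=\phi_{i,j}$, $a,b\in\mathbb Z$. $\|\phi\|_\infty=\max_{i,j}|\phi_{i,j}|$. For a vertex-centered periodic grid function $f_{k+\frac12,l+\frac12}=f(p_{k+\frac12},p_{l+\frac12})$ and periodic $\phi\in\mathcal C_{m\times n}$, the discrete convolution is $[f\star\phi]_{i,j}=h^2\sum_{k=1}^m\sum_{l=1}^n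 f_{k+\frac12,l+\frac12}\,\phi_{i-k,j-l}$. $J_c,J_e$ denote the vertex-centered grid restrictions $(J_\alpha)_{i+\frac12,j+\frac12}=\mathsf J_\alpha(p_{i+\frac12},p_{j+\frac12})$, $J=J_c-J_e$, and $\mathbf 1$ is the constant grid function 1 (so $[J_\alpha\star\mathbf 1]$ is a constant). Fully discrete nAC scheme with time step $s>0$: given periodic $\phi^{k-1},\phi^k\in\mathcal C_{m\times n}$, $k\ge0$, with the convention $\phi^{-1}:=\phi^0$, find periodic $\phi^{k+1}\in\mathcal C_{m\times n}$ (it exists and is unique) such that $$\phi^{k+1}-\phi^k=-M s\,w^{k+1/2},$$ $$w^{k+1/2}=\eta(\phi^k,\phi^{k+1})+([J_c\star\mathbf 1]+\gamma_c)\phi^{k+1/2}-([J_e\star\mathbf 1]+\gamma_e)\hat\phi^{k+1/2}-[J\star\hat\phi^{k+1/2}],$$ where $\eta(\phi^k,\phi^{k+1})=\tfrac14\big((\phi^k)^2+(\phi^{k+1})^2\big)(\phi^k+\phi^{k+1})$, $\phi^{k+1/2}=\tfrac12(\phi^k+\phi^{k+1})$, $\hat\phi^{k+1/2}=\tfrac32\phi^k-\tfrac12\phi^{k-1}$. *)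

theory Defs
  imports "HOL-Analysis.Analysis"
begin

text \<open>
  \<open>Ck_on k S f\<close>: all directional derivatives of \<open>f\<close> of order at most \<open>k\<close> exist and are
  continuous on \<open>S\<close>.  Derivatives are taken within \<open>S\<close>, so on a closed set with nonempty
  interior (such as a space-time slab) this is regularity up to the boundary, with one-sided
  derivatives there.
\<close>

primrec Ck_on :: "nat \<Rightarrow> 'a::real_normed_vector set \<Rightarrow> ('a \<Rightarrow> real) \<Rightarrow> bool" where
  "Ck_on 0 S f \<longleftrightarrow> continuous_on S f"
| "Ck_on (Suc k) S f \<longleftrightarrow>
     (\<exists>f'. (\<forall>x\<in>S. (f has_derivative f' x) (at x within S)) \<and> (\<forall>v. Ck_on k S (\<lambda>x. f' x v)))"

definition smooth_on :: "'a::real_normed_vector set \<Rightarrow> ('a \<Rightarrow> real) \<Rightarrow> bool" where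
  "smooth_on S f \<longleftrightarrow> (\<forall>k. Ck_on k S f)"

definition Omega :: "real \<Rightarrow> real \<Rightarrow> (real \<times> real) set" where
  "Omega L1 L2 = {0<..<L1} \<times> {0<..<L2}"

definition periodic_fun2 :: "real \<Rightarrow> real \<Rightarrow> (real \<times> real \<Rightarrow> real) \<Rightarrow> bool" where
  "periodic_fun2 L1 L2 f \<longleftrightarrow> (\<forall>x. f (x + (L1, 0)) = f x \<and> f (x + (0, L2)) = f x)"

definition smooth_per :: "real \<Rightarrow> real \<Rightarrow> (real \<times> real \<Rightarrow> real) \<Rightarrow> bool" where
  "smooth_per L1 L2 f \<longleftrightarrow> smooth_on UNIV f \<and> periodic_fun2 L1 L2 f"

definition per_conv ::
  "real \<Rightarrow> real \<Rightarrow> (real \<times> real \<Rightarrow> real) \<Rightarrow> (real \<times> real \<Rightarrow> real) \<Rightarrow> real \<times> real \<Rightarrow> real" where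
  "per_conv L1 L2 J \<phi> x = integral (Omega L1 L2) (\<lambda>y. J y * \<phi> (x - y))"

definition kernel_assms ::
  "real \<Rightarrow> real \<Rightarrow> (real \<times> real \<Rightarrow> real) \<Rightarrow> (real \<times> real \<Rightarrow> real) \<Rightarrow> bool" where
  "kernel_assms L1 L2 Jc Je \<longleftrightarrow>
     smooth_per L1 L2 Jc \<and> smooth_per L1 L2 Je \<and>
     (\<forall>x. 0 \<le> Jc x) \<and> (\<forall>x. 0 \<le> Je x) \<and>
     (\<forall>x. Jc (- x) = Jc x) \<and> (\<forall>x. Je (- x) = Je x) \<and>
     0 < integral (Omega L1 L2) (\<lambda>x. Jc x - Je x)"

definition nAC_solution ::
  "real \<Rightarrow> real \<Rightarrow> real \<Rightarrow> (real \<times> real \<Rightarrow> real) \<Rightarrow> (real \<times> real \<Rightarrow> real) \<Rightarrow> real \<Rightarrow> real \<Rightarrow> real \<Rightarrow>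
   (real \<times> real \<Rightarrow> real) \<Rightarrow> (real \<times> real \<Rightarrow> real \<Rightarrow> real) \<Rightarrow> bool" where
  "nAC_solution L1 L2 M Jc Je \<gamma>c \<gamma>e T \<Phi>0 \<Phi> \<longleftrightarrow>
     smooth_on (UNIV \<times> {0..T}) (\<lambda>(x, t). \<Phi> x t) \<and>
     (\<forall>t\<in>{0..T}. periodic_fun2 L1 L2 (\<lambda>x. \<Phi> x t)) \<and>
     (\<forall>x. \<Phi> x 0 = \<Phi>0 x) \<and>
     (\<forall>x. \<forall>t\<in>{0..T}.
        ((\<lambda>\<tau>. \<Phi> x \<tau>) has_real_derivative
           - M * ((\<Phi> x t) ^ 3 + \<gamma>c * \<Phi> x t - \<gamma>e * \<Phi> x t
                  + per_conv L1 L2 (\<lambda>y. Jc y - Je y) (\<lambda>_. 1) x * \<Phi> x t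
                  - per_conv L1 L2 (\<lambda>y. Jc y - Je y) (\<lambda>y. \<Phi> y t) x))
        (at t within {0..T}))"

text \<open>
  Grid functions are indexed by all of \<open>int \<times> int\<close>, periodicity being imposed separately.
  A cell-centered \<open>\<phi>\<close> has \<open>\<phi> i j\<close> for the value at \<open>(p\<^sub>i, p\<^sub>j)\<close>; a vertex-centered \<open>f\<close> has
  \<open>f k l\<close> for the value at \<open>(p\<^bsub>k+1/2\<^esub>, p\<^bsub>l+1/2\<^esub>)\<close>.
\<close>

type_synonym grid_fun = "int \<Rightarrow> int \<Rightarrow> real"

definition grid_point :: "real \<Rightarrow> real \<Rightarrow> real" where
  "grid_point h r = (r - 1/2) * h"

definition cell_restrict :: "real \<Rightarrow> (real \<times> real \<Rightarrow> real) \<Rightarrow> grid_fun" where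
  "cell_restrict h u i j = u (grid_point h (of_int i), grid_point h (of_int j))"

definition vertex_restrict :: "real \<Rightarrow> (real \<times> real \<Rightarrow> real) \<Rightarrow> grid_fun" where
  "vertex_restrict h u k l = u (grid_point h (of_int k + 1/2), grid_point h (of_int l + 1/2))"

definition grid_periodic :: "nat \<Rightarrow> nat \<Rightarrow> grid_fun \<Rightarrow> bool" where
  "grid_periodic m n \<phi> \<longleftrightarrow> (\<forall>i j a b. \<phi> (i + a * int m) (j + b * int n) = \<phi> i j)"

definition grid_max_norm :: "nat \<Rightarrow> nat \<Rightarrow> grid_fun \<Rightarrow> real" where
  "grid_max_norm m n \<phi> = Max ((\<lambda>(i, j). \<bar>\<phi> i j\<bar>) ` ({1..int m} \<times> {1..int n}))"

definition grid_conv :: "real \<Rightarrow> nat \<Rightarrow> nat \<Rightarrow> grid_fun \<Rightarrow> grid_fun \<Rightarrow> grid_fun" where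
  "grid_conv h m n f \<phi> i j = h^2 * (\<Sum>k = 1..int m. \<Sum>l = 1..int n. f k l * \<phi> (i - k) (j - l))"

definition eta :: "real \<Rightarrow> real \<Rightarrow> real" where
  "eta a b = 1/4 * (a^2 + b^2) * (a + b)"

text \<open>
  The chemical potential \<open>w\<^bsup>k+1/2\<^esup>\<close>, where \<open>\<phi>p\<close>, \<open>\<phi>\<close>, \<open>\<phi>n\<close> are the previous, current and next iterates
  \<open>\<phi>\<^bsup>k-1\<^esup>\<close>, \<open>\<phi>\<^bsup>k\<^esup>\<close>, \<open>\<phi>\<^bsup>k+1\<^esup>\<close> and \<open>Jc\<close>, \<open>Je\<close> are vertex-centered.
\<close>

definition chem_pot ::
  "real \<Rightarrow> nat \<Rightarrow> nat \<Rightarrow> grid_fun \<Rightarrow> grid_fun \<Rightarrow> real \<Rightarrow> real \<Rightarrow> grid_fun \<Rightarrow> grid_fun \<Rightarrow> grid_fun \<Rightarrow> grid_fun" where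
  "chem_pot h m n Jc Je \<gamma>c \<gamma>e \<phi>p \<phi> \<phi>n i j =
     (let half = (\<lambda>i j. 1/2 * (\<phi> i j + \<phi>n i j));
          hat = (\<lambda>i j. 3/2 * \<phi> i j - 1/2 * \<phi>p i j)
      in eta (\<phi> i j) (\<phi>n i j)
         + (grid_conv h m n Jc (\<lambda>_ _. 1) i j + \<gamma>c) * half i j
         - (grid_conv h m n Je (\<lambda>_ _. 1) i j + \<gamma>e) * hat i j
         - grid_conv h m n (\<lambda>k l. Jc k l - Je k l) hat i j)"

definition nAC_scheme ::
  "real \<Rightarrow> real \<Rightarrow> nat \<Rightarrow> nat \<Rightarrow> real \<Rightarrow> (real \<times> real \<Rightarrow> real) \<Rightarrow> (real \<times> real \<Rightarrow> real) \<Rightarrow> real \<Rightarrow> real \<Rightarrow>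
   grid_fun \<Rightarrow> (nat \<Rightarrow> grid_fun) \<Rightarrow> bool" where
  "nAC_scheme s h m n M Jc Je \<gamma>c \<gamma>e \<phi>0 \<phi> \<longleftrightarrow>
     \<phi> 0 = \<phi>0 \<and>
     (\<forall>k. grid_periodic m n (\<phi> k)) \<and>
     (\<forall>k i j. \<phi> (Suc k) i j - \<phi> k i j =
        - M * s * chem_pot h m n (vertex_restrict h Jc) (vertex_restrict h Je) \<gamma>c \<gamma>e
                    (if k = 0 then \<phi> 0 else \<phi> (k - 1)) (\<phi> k) (\<phi> (Suc k)) i j)"

end

theory Submission
  imports Defs
begin

text \<open>
  Since \<open>eta a b\<close> is nondecreasing in \<open>b\<close> and the other implicit term is a nonnegative multiple of the
  new iterate, one step of the scheme amplifies the maximum-norm error by at most \<open>1 + \<Lambda> s\<close>, as long as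
  the old error is at most 1 (so that \<open>eta\<close> is Lipschitz in its first argument).  The local error is of
  order \<open>s (h\<^sup>2 + s\<^sup>2)\<close>: in time, compare with the trapezoidal rule, using
  \<open>(A\<^sup>3 + B\<^sup>3) / 2 - eta A B = (A - B)\<^sup>2 (A + B) / 4\<close>; in space, the rectangle rule for a
  periodic integrand is the trapezoidal rule.  The first step, where the extrapolation degenerates to
  \<open>\<phi>\<^sup>0\<close>, has local error \<open>s (h\<^sup>2 + s)\<close>, which is harmless because it occurs only once.  A discrete
  Gronwall argument then yields the bound \<open>C (h\<^sup>2 + s\<^sup>2)\<close>, which for small \<open>s\<close> and \<open>h\<close> is below 1 and so
  closes the induction.
\<close>

section \<open>Derivatives along lines\<close>

lemma Ck_on_imp_continuous_on: "Ck_on k S f \<Longrightarrow> continuous_on S f"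
  by (cases k) (auto intro: has_derivative_continuous_on)

lemma Ck_on_diff: "Ck_on k S f \<Longrightarrow> Ck_on k S g \<Longrightarrow> Ck_on k S (\<lambda>x. f x - g x)"
proof (induction k arbitrary: f g)
  case 0
  then show ?case by (auto intro: continuous_intros)
next
  case (Suc k)
  from Suc.prems(1) obtain f' where f: "\<forall>x\<in>S. (f has_derivative f' x) (at x within S)"
    "\<forall>v. Ck_on k S (\<lambda>x. f' x v)" by auto
  from Suc.prems(2) obtain g' where g: "\<forall>x\<in>S. (g has_derivative g' x) (at x within S)"
    "\<forall>v. Ck_on k S (\<lambda>x. g' x v)" by auto
  show ?case
    unfolding Ck_on.simps
    by (rule exI[of _ "\<lambda>x v. f' x v - g' x v"])
       (use f g Suc.IH in \<open>auto intro: has_derivative_diff\<close>)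
qed

lemma Ck_on_const: "Ck_on k S (\<lambda>_. c)"
proof (induction k arbitrary: c)
  case (Suc k)
  show ?case
    unfolding Ck_on.simps by (rule exI[of _ "\<lambda>_ _. 0"]) (use Suc in auto)
qed auto

text \<open>The parameter set \<open>I\<close> is arbitrary, subject only to the segment staying in
  \<open>S\<close>: the same \<open>g\<close> then serves on every subinterval, and on a closed
  space-time slab the derivatives at the two end times are one-sided.\<close>

definition has_line_deriv ::
  "'a::real_normed_vector set \<Rightarrow> 'a \<Rightarrow> ('a \<Rightarrow> real) \<Rightarrow> ('a \<Rightarrow> real) \<Rightarrow> bool" where
  "has_line_deriv S v f g \<longleftrightarrow>
     (\<forall>x \<tau> I. (\<forall>u\<in>I. x + u *\<^sub>R v \<in> S) \<longrightarrow> \<tau> \<in> I \<longrightarrow>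
       ((\<lambda>u. f (x + u *\<^sub>R v)) has_real_derivative g (x + \<tau> *\<^sub>R v)) (at \<tau> within I))"

lemma has_line_derivD:
  assumes "has_line_deriv S v f g" "\<And>u. u \<in> I \<Longrightarrow> x + u *\<^sub>R v \<in> S" "\<tau> \<in> I"
  shows "((\<lambda>u. f (x + u *\<^sub>R v)) has_real_derivative g (x + \<tau> *\<^sub>R v)) (at \<tau> within I)"
  using assms unfolding has_line_deriv_def by blast

text \<open>Chain rule along the affine path through \<open>x\<close> in direction \<open>v\<close>.
  The witness is \<open>f' x v\<close>, whose regularity is part of the recursive clause for
  \<open>Ck_on\<close>.\<close>

lemma Ck_on_Suc_line:
  assumes "Ck_on (Suc k) S f"
  obtains g where "Ck_on k S g" "has_line_deriv S v f g"
proof -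
  from assms obtain f' where f: "\<And>x. x \<in> S \<Longrightarrow> (f has_derivative f' x) (at x within S)"
    "\<And>v. Ck_on k S (\<lambda>x. f' x v)" by auto
  show thesis
  proof (rule that)
    show "Ck_on k S (\<lambda>x. f' x v)" by fact
    show "has_line_deriv S v f (\<lambda>x. f' x v)"
      unfolding has_line_deriv_def
    proof (intro allI impI)
      fix x \<tau> I assume I: "\<forall>u\<in>I. x + u *\<^sub>R v \<in> S" and \<tau>: "\<tau> \<in> I"
      let ?c = "\<lambda>u. x + u *\<^sub>R v"
      have c: "(?c has_derivative (\<lambda>u. u *\<^sub>R v)) (at \<tau> within I)"
        by (auto intro!: derivative_eq_intros)
      have "(f has_derivative f' (?c \<tau>)) (at (?c \<tau>) within ?c ` I)"
        by (rule has_derivative_subset[OF f(1)]) (use I \<tau> in auto)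
      from diff_chain_within[OF c this]
      have "((\<lambda>u. f (?c u)) has_derivative (\<lambda>u. f' (?c \<tau>) (u *\<^sub>R v))) (at \<tau> within I)"
        by (simp add: o_def)
      moreover have "?c \<tau> \<in> S" using I \<tau> by auto
      then have "(\<lambda>u. f' (?c \<tau>) (u *\<^sub>R v)) = (*) (f' (?c \<tau>) v)"
        using linear_scale[OF has_derivative_linear[OF f(1)]] by (auto simp: mult.commute)
      ultimately show "((\<lambda>u. f (?c u)) has_real_derivative f' (?c \<tau>) v) (at \<tau> within I)"
        by (simp add: has_field_derivative_def)
    qed
  qed
qed

text \<open>Three derivatives are what the trapezoidal rule consumes in time; in space, where the
  integrand is itself the derivative of its indefinite integral, two are used.\<close>

lemma smooth_on_line3:
  assumes "smooth_on S f"
  obtains g1 g2 g3 where "continuous_on S g1" "continuous_on S g2" "continuous_on S g3"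
    "has_line_deriv S v f g1" "has_line_deriv S v g1 g2" "has_line_deriv S v g2 g3"
proof -
  have "Ck_on (Suc (Suc (Suc 0))) S f" using assms unfolding smooth_on_def by blast
  from Ck_on_Suc_line[OF this, of v]
  obtain g1 where g1: "Ck_on (Suc (Suc 0)) S g1" "has_line_deriv S v f g1" .
  from Ck_on_Suc_line[OF g1(1), of v]
  obtain g2 where g2: "Ck_on (Suc 0) S g2" "has_line_deriv S v g1 g2" .
  from Ck_on_Suc_line[OF g2(1), of v]
  obtain g3 where g3: "Ck_on 0 S g3" "has_line_deriv S v g2 g3" .
  show thesis
    using that g1 g2 g3 Ck_on_imp_continuous_on by blast
qed

lemma continuous_on_compact_bound:
  fixes f :: "'a::topological_space \<Rightarrow> real"
  assumes "compact K" "continuous_on K f"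
  obtains B where "0 \<le> B" "\<And>x. x \<in> K \<Longrightarrow> \<bar>f x\<bar> \<le> B"
proof -
  have "bounded (f ` K)"
    using compact_continuous_image[OF assms(2,1)] by (rule compact_imp_bounded)
  then obtain B where "\<forall>y\<in>f ` K. \<bar>y\<bar> \<le> B"
    unfolding bounded_iff by auto
  then show thesis
    by (intro that[of "max B 0"]) (auto simp: le_max_iff_disj)
qed

lemma derivative_bound_imp_Lipschitz:
  fixes f f' :: "real \<Rightarrow> real"
  assumes "\<And>x. x \<in> {a..b} \<Longrightarrow> (f has_real_derivative f' x) (at x within {a..b})"
    and "\<And>x. x \<in> {a..b} \<Longrightarrow> \<bar>f' x\<bar> \<le> K" and "x \<in> {a..b}" and "y \<in> {a..b}"
  shows "\<bar>f y - f x\<bar> \<le> K * \<bar>y - x\<bar>"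
  using field_differentiable_bound[of "{a..b}" f f' K y x] assms by (simp add: norm_minus_commute)

section \<open>Trapezoidal rule\<close>

text \<open>Nested mean value estimates: the defect \<open>e u\<close> of the rule on
  \<open>{a..u}\<close> vanishes at \<open>a\<close>, and its derivative is quadratically small
  because \<open>f2\<close> is Lipschitz with constant \<open>K\<close>. Being phrased for an
  antiderivative, the estimate serves both the time step (\<open>f\<close> a solution of the
  equation) and quadrature (\<open>f\<close> an indefinite integral).\<close>

lemma trapezoid_antiderivative:
  fixes f :: "real \<Rightarrow> real"
  assumes "a \<le> b"
    and f: "\<And>x. x \<in> {a..b} \<Longrightarrow> (f has_real_derivative f1 x) (at x within {a..b})"
    and f1: "\<And>x. x \<in> {a..b} \<Longrightarrow> (f1 has_real_derivative f2 x) (at x within {a..b})"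
    and f2: "\<And>x. x \<in> {a..b} \<Longrightarrow> (f2 has_real_derivative f3 x) (at x within {a..b})"
    and K: "\<And>x. x \<in> {a..b} \<Longrightarrow> \<bar>f3 x\<bar> \<le> K"
  shows "\<bar>f b - f a - (b - a) / 2 * (f1 a + f1 b)\<bar> \<le> K * (b - a) ^ 3"
proof -
  have K0: "0 \<le> K" using K[of a] assms(1) by auto
  define e where "e u = f u - f a - (u - a) / 2 * (f1 a + f1 u)" for u
  define e' where "e' u = (f1 u - f1 a - (u - a) * f2 u) / 2" for u
  have e: "(e has_real_derivative e' u) (at u within {a..b})" if "u \<in> {a..b}" for u
    unfolding e_def e'_def
    by (rule derivative_eq_intros f[OF that] f1[OF that] refl | simp add: field_simps)+
  have e'_bound: "\<bar>e' u\<bar> \<le> K * (b - a)\<^sup>2" if u: "u \<in> {a..b}" for u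
  proof -
    \<comment> \<open>Freezing the slope of \<open>f1\<close> at \<open>u\<close> makes
      \<open>e' u\<close> half the increment of \<open>g\<close> over \<open>{a..u}\<close>, and
      \<open>g\<close> has the small derivative \<open>f2 v - f2 u\<close>.\<close>
    define g where "g v = f1 v - v * f2 u" for v
    have "(g has_real_derivative f2 v - f2 u) (at v within {a..u})" if "v \<in> {a..u}" for v
      unfolding g_def
      by (rule derivative_eq_intros has_field_derivative_subset[OF f1] refl | use that u in \<open>simp\<close>)+
    moreover have "\<bar>f2 v - f2 u\<bar> \<le> K * (b - a)" if "v \<in> {a..u}" for v
    proof -
      have "\<bar>f2 v - f2 u\<bar> \<le> K * \<bar>v - u\<bar>"
        by (rule derivative_bound_imp_Lipschitz[OF f2 K]) (use that u in auto)
      also have "\<dots> \<le> K * (b - a)" by (intro mult_left_mono K0) (use that u in auto)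
      finally show ?thesis .
    qed
    ultimately have "\<bar>g u - g a\<bar> \<le> K * (b - a) * \<bar>u - a\<bar>"
      by (rule derivative_bound_imp_Lipschitz) (use u in auto)
    also have "\<dots> \<le> K * (b - a) * (b - a)" by (intro mult_left_mono) (use u K0 in auto)
    finally have "\<bar>g u - g a\<bar> \<le> K * (b - a)\<^sup>2" by (simp add: power2_eq_square mult.assoc)
    moreover have "e' u = (g u - g a) / 2" by (simp add: e'_def g_def algebra_simps)
    ultimately show ?thesis by simp
  qed
  have "\<bar>e b - e a\<bar> \<le> K * (b - a)\<^sup>2 * \<bar>b - a\<bar>"
    by (rule derivative_bound_imp_Lipschitz[OF e e'_bound]) (use assms(1) in auto)
  then show ?thesis using assms(1) by (simp add: e_def power2_eq_square power3_eq_cube algebra_simps)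
qed

lemma trapezoid_cell:
  fixes g :: "real \<Rightarrow> real"
  assumes ab: "a \<le> b"
    and g: "\<And>x. x \<in> {a..b} \<Longrightarrow> (g has_real_derivative g1 x) (at x within {a..b})"
    and g1: "\<And>x. x \<in> {a..b} \<Longrightarrow> (g1 has_real_derivative g2 x) (at x within {a..b})"
    and K: "\<And>x. x \<in> {a..b} \<Longrightarrow> \<bar>g2 x\<bar> \<le> K"
  shows "\<bar>integral {a..b} g - (b - a) / 2 * (g a + g b)\<bar> \<le> K * (b - a) ^ 3"
proof -
  have "continuous_on {a..b} g" by (rule DERIV_continuous_on[OF g])
  then have "((\<lambda>u. integral {a..u} g) has_real_derivative g x) (at x within {a..b})"
    if "x \<in> {a..b}" for x using that by (rule integral_has_real_derivative)
  from trapezoid_antiderivative[OF ab this g g1 K] show ?thesis by simp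
qed

text \<open>The \<open>m\<close> cell errors \<open>K * h ^ 3\<close> add up to
  \<open>K * (real m * h) * h\<^sup>2\<close>. The trapezoidal sum is written as a right-endpoint
  sum plus a boundary correction, so that the correction disappears for periodic integrands.\<close>

lemma trapezoid_composite:
  fixes g :: "real \<Rightarrow> real"
  assumes h: "0 < h"
    and g: "\<And>x. x \<in> {0..real m * h} \<Longrightarrow> (g has_real_derivative g1 x) (at x within {0..real m * h})"
    and g1: "\<And>x. x \<in> {0..real m * h} \<Longrightarrow> (g1 has_real_derivative g2 x) (at x within {0..real m * h})"
    and K: "\<And>x. x \<in> {0..real m * h} \<Longrightarrow> \<bar>g2 x\<bar> \<le> K"
  shows "\<bar>integral {0..real m * h} g
          - h * ((\<Sum>k=1..int m. g (of_int k * h)) + (g 0 - g (real m * h)) / 2)\<bar> \<le> K * (real m * h) * h\<^sup>2"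
  using g g1 K
proof (induction m)
  case 0
  then show ?case by simp
next
  case (Suc m)
  let ?a = "real m * h" and ?b = "real (Suc m) * h"
  have sub: "{0..?a} \<subseteq> {0..?b}" "{?a..?b} \<subseteq> {0..?b}" and ab: "0 \<le> ?a" "?a \<le> ?b"
    using h by (auto simp: field_simps)
  have IH: "\<bar>integral {0..?a} g
          - h * ((\<Sum>k=1..int m. g (of_int k * h)) + (g 0 - g ?a) / 2)\<bar> \<le> K * ?a * h\<^sup>2"
    by (intro Suc.IH) (use sub Suc.prems in \<open>auto intro: has_field_derivative_subset[OF _ sub(1)] simp del: of_nat_Suc\<close>)
  have cell: "\<bar>integral {?a..?b} g - (?b - ?a) / 2 * (g ?a + g ?b)\<bar> \<le> K * (?b - ?a) ^ 3"
    using sub Suc.prems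
    by (intro trapezoid_cell[OF ab(2), of g g1 g2] has_field_derivative_subset[OF _ sub(2)]) blast+
  have "continuous_on {0..?b} g" by (rule DERIV_continuous_on[OF Suc.prems(1)])
  then have "integral {0..?a} g + integral {?a..?b} g = integral {0..?b} g"
    by (intro Henstock_Kurzweil_Integration.integral_combine ab integrable_continuous_real)
  moreover have ba: "?b - ?a = h" by (simp add: algebra_simps)
  moreover have "{1..int (Suc m)} = insert (int m + 1) {1..int m}" by auto
  then have "(\<Sum>k=1..int (Suc m). g (of_int k * h)) = (\<Sum>k=1..int m. g (of_int k * h)) + g ?b"
    by (simp add: algebra_simps)
  moreover have "K * ?b * h\<^sup>2 = K * ?a * h\<^sup>2 + K * h ^ 3"
    by (simp add: power2_eq_square power3_eq_cube algebra_simps)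
  ultimately have "integral {0..?b} g - h * ((\<Sum>k=1..int (Suc m). g (of_int k * h)) + (g 0 - g ?b) / 2)
      = (integral {0..?a} g - h * ((\<Sum>k=1..int m. g (of_int k * h)) + (g 0 - g ?a) / 2))
        + (integral {?a..?b} g - (?b - ?a) / 2 * (g ?a + g ?b))"
    and "K * ?b * h\<^sup>2 = K * ?a * h\<^sup>2 + K * (?b - ?a) ^ 3"
    by (simp_all add: field_simps del: of_nat_Suc)
  then show ?case using IH cell by linarith
qed

lemma rectangle_rule_periodic:
  fixes g :: "real \<Rightarrow> real"
  assumes "0 < h" "L = real m * h" "g L = g 0"
    and "\<And>x. x \<in> {0..L} \<Longrightarrow> (g has_real_derivative g1 x) (at x within {0..L})"
    and "\<And>x. x \<in> {0..L} \<Longrightarrow> (g1 has_real_derivative g2 x) (at x within {0..L})"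
    and "\<And>x. x \<in> {0..L} \<Longrightarrow> \<bar>g2 x\<bar> \<le> K"
  shows "\<bar>integral {0..L} g - h * (\<Sum>k=1..int m. g (of_int k * h))\<bar> \<le> K * L * h\<^sup>2"
  using trapezoid_composite[of h m g g1 g2 K] assms by simp

text \<open>The one-dimensional rule is used twice: in \<open>y\<close> for every fixed
  \<open>x\<close>, with the error then integrated over \<open>x\<close>, and in \<open>x\<close>
  along each grid line, with the errors then summed over the lines. Each pass contributes
  \<open>K * L1 * L2 * h\<^sup>2\<close>.\<close>

lemma rectangle_rule_periodic_2d:
  fixes G :: "real \<times> real \<Rightarrow> real"
  assumes h: "0 < h" and L1: "L1 = real m * h" and L2: "L2 = real n * h"
    and cont: "continuous_on (cbox (0, 0) (L1, L2)) G"
    and per1: "\<And>y. y \<in> {0..L2} \<Longrightarrow> G (L1, y) = G (0, y)"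
    and per2: "\<And>x. x \<in> {0..L1} \<Longrightarrow> G (x, L2) = G (x, 0)"
    and d1: "\<And>x y. x \<in> {0..L1} \<Longrightarrow> y \<in> {0..L2} \<Longrightarrow>
      ((\<lambda>x. G (x, y)) has_real_derivative D1 (x, y)) (at x within {0..L1})"
    and d11: "\<And>x y. x \<in> {0..L1} \<Longrightarrow> y \<in> {0..L2} \<Longrightarrow>
      ((\<lambda>x. D1 (x, y)) has_real_derivative D11 (x, y)) (at x within {0..L1})"
    and d2: "\<And>x y. x \<in> {0..L1} \<Longrightarrow> y \<in> {0..L2} \<Longrightarrow>
      ((\<lambda>y. G (x, y)) has_real_derivative D2 (x, y)) (at y within {0..L2})"
    and d22: "\<And>x y. x \<in> {0..L1} \<Longrightarrow> y \<in> {0..L2} \<Longrightarrow>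
      ((\<lambda>y. D2 (x, y)) has_real_derivative D22 (x, y)) (at y within {0..L2})"
    and K1: "\<And>x y. x \<in> {0..L1} \<Longrightarrow> y \<in> {0..L2} \<Longrightarrow> \<bar>D11 (x, y)\<bar> \<le> K"
    and K2: "\<And>x y. x \<in> {0..L1} \<Longrightarrow> y \<in> {0..L2} \<Longrightarrow> \<bar>D22 (x, y)\<bar> \<le> K"
  shows "\<bar>integral (cbox (0, 0) (L1, L2)) G
      - h\<^sup>2 * (\<Sum>k=1..int m. \<Sum>l=1..int n. G (of_int k * h, of_int l * h))\<bar> \<le> 2 * K * L1 * L2 * h\<^sup>2"
proof -
  have L0: "0 \<le> L1" "0 \<le> L2" using h L1 L2 by auto
  define S where "S x = h * (\<Sum>l=1..int n. G (x, of_int l * h))" for x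
  have row: "\<bar>integral {0..L2} (\<lambda>y. G (x, y)) - S x\<bar> \<le> K * L2 * h\<^sup>2" if "x \<in> {0..L1}" for x
    unfolding S_def
    by (rule rectangle_rule_periodic[OF h L2 per2[OF that] d2[OF that] d22[OF that] K2[OF that]])
  have grid: "of_int l * h \<in> {0..L2}" if "l \<in> {1..int n}" for l
  proof -
    have "real_of_int l \<le> real n" using that by auto
    then show ?thesis using that h by (simp add: L2 mult_right_mono)
  qed
  have int_G: "(\<lambda>x. G (x, y)) integrable_on {0..L1}" if "y \<in> {0..L2}" for y
    using DERIV_continuous_on[OF d1[OF _ that]] by (rule integrable_continuous_real)
  have int_S: "S integrable_on {0..L1}"
    unfolding S_def by (intro integrable_on_mult_right integrable_sum int_G grid) auto
  have cont_inner: "continuous_on {0..L1} (\<lambda>x. integral {0..L2} (\<lambda>y. G (x, y)))"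
    using integral_continuous_on_param[of "{0..L1}" 0 L2 "\<lambda>x y. G (x, y)"] cont
    by (simp add: case_prod_unfold cbox_Pair_eq)
  have int_inner: "(\<lambda>x. integral {0..L2} (\<lambda>y. G (x, y))) integrable_on {0..L1}"
    by (rule integrable_continuous_real[OF cont_inner])
  have "integral (cbox (0, 0) (L1, L2)) G - integral {0..L1} S
      = integral {0..L1} (\<lambda>x. integral {0..L2} (\<lambda>y. G (x, y)) - S x)"
    using integral_prod_continuous[OF cont]
    by (simp add: Henstock_Kurzweil_Integration.integral_diff[OF int_inner int_S])
  also have "\<bar>\<dots>\<bar> \<le> (K * L2 * h\<^sup>2) * (L1 - 0)"
  proof -
    have "((\<lambda>x. integral {0..L2} (\<lambda>y. G (x, y)) - S x) has_integral
        integral {0..L1} (\<lambda>x. integral {0..L2} (\<lambda>y. G (x, y)) - S x)) (cbox 0 L1)"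
      using integrable_integral[OF integrable_diff[OF int_inner int_S]] by simp
    \<comment> \<open>The integral bound asks for a non-negative constant, which follows from the
      row estimate at \<open>0\<close>.\<close>
    from has_integral_bound[OF _ this, of "K * L2 * h\<^sup>2"] row order_trans[OF _ row[of 0]]
    show ?thesis using L0 by simp
  qed
  finally have 1: "\<bar>integral (cbox (0, 0) (L1, L2)) G - integral {0..L1} S\<bar> \<le> K * L1 * L2 * h\<^sup>2"
    by (simp add: mult_ac)
  have "integral {0..L1} S = h * (\<Sum>l=1..int n. integral {0..L1} (\<lambda>x. G (x, of_int l * h)))"
    unfolding S_def
    by (subst Henstock_Kurzweil_Integration.integral_mult_right, subst integral_sum) (auto intro: int_G[OF grid])
  moreover have "(\<Sum>k=1..int m. \<Sum>l=1..int n. G (of_int k * h, of_int l * h))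
      = (\<Sum>l=1..int n. \<Sum>k=1..int m. G (of_int k * h, of_int l * h))"
    by (rule sum.swap)
  ultimately have "integral {0..L1} S - h\<^sup>2 * (\<Sum>k=1..int m. \<Sum>l=1..int n. G (of_int k * h, of_int l * h))
      = h * (\<Sum>l=1..int n. integral {0..L1} (\<lambda>x. G (x, of_int l * h))
                 - h * (\<Sum>k=1..int m. G (of_int k * h, of_int l * h)))"
    by (simp add: sum_subtractf sum_distrib_left power2_eq_square algebra_simps)
  also have "\<bar>\<dots>\<bar> \<le> h * (\<Sum>l=1..int n. K * L1 * h\<^sup>2)"
  proof -
    have col: "\<bar>integral {0..L1} (\<lambda>x. G (x, of_int l * h)) - h * (\<Sum>k=1..int m. G (of_int k * h, of_int l * h))\<bar>
        \<le> K * L1 * h\<^sup>2" if "l \<in> {1..int n}" for l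
      by (rule rectangle_rule_periodic[OF h L1 _ d1 d11 K1]) (use grid[OF that] per1 in auto)
    show ?thesis
      unfolding abs_mult abs_of_pos[OF h] using h
      by (intro mult_left_mono order_trans[OF sum_abs] sum_mono col) auto
  qed
  also have "\<dots> = K * L1 * L2 * h\<^sup>2" by (simp add: L2)
  finally show ?thesis using 1 by linarith
qed

section \<open>Error of the discrete convolution\<close>

text \<open>Product rule for the convolution integrand: as \<open>y\<close> moves along
  \<open>v\<close>, the second factor moves along \<open>- v\<close> in space at fixed time. The
  bound \<open>K\<close> on the second derivative is uniform in \<open>x\<close> and
  \<open>t\<close>, which later makes the quadrature constant independent of the grid and of the
  time level.\<close>

lemma conv_integrand_line:
  fixes J :: "real \<times> real \<Rightarrow> real" and F :: "(real \<times> real) \<times> real \<Rightarrow> real"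
  assumes J: "smooth_on UNIV J" and F: "smooth_on (UNIV \<times> {0..T}) F"
  obtains D E :: "real \<times> real \<Rightarrow> real \<Rightarrow> real \<times> real \<Rightarrow> real" and K where "0 \<le> K"
    "\<And>x t y \<tau> I. t \<in> {0..T} \<Longrightarrow> \<tau> \<in> I \<Longrightarrow>
       ((\<lambda>u. J (y + u *\<^sub>R v) * F (x - (y + u *\<^sub>R v), t)) has_real_derivative D x t (y + \<tau> *\<^sub>R v)) (at \<tau> within I)"
    "\<And>x t y \<tau> I. t \<in> {0..T} \<Longrightarrow> \<tau> \<in> I \<Longrightarrow>
       ((\<lambda>u. D x t (y + u *\<^sub>R v)) has_real_derivative E x t (y + \<tau> *\<^sub>R v)) (at \<tau> within I)"
    "\<And>x t y. x \<in> cbox (0, 0) (L1, L2) \<Longrightarrow> t \<in> {0..T} \<Longrightarrow> y \<in> cbox (0, 0) (L1, L2) \<Longrightarrow> \<bar>E x t y\<bar> \<le> K"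
proof -
  obtain J1 J2 where J1: "continuous_on UNIV J1" "continuous_on UNIV J2"
    "has_line_deriv UNIV v J J1" "has_line_deriv UNIV v J1 J2"
    by (rule smooth_on_line3[OF J])
  obtain F1 F2 where F1: "continuous_on (UNIV \<times> {0..T}) F1" "continuous_on (UNIV \<times> {0..T}) F2"
    "has_line_deriv (UNIV \<times> {0..T}) (- v, 0) F F1" "has_line_deriv (UNIV \<times> {0..T}) (- v, 0) F1 F2"
    by (rule smooth_on_line3[OF F])
  have J0: "continuous_on UNIV J" and F0: "continuous_on (UNIV \<times> {0..T}) F"
    using J F unfolding smooth_on_def by (blast intro: Ck_on_imp_continuous_on)+
  define D where "D x t y = J1 y * F (x - y, t) + J y * F1 (x - y, t)" for x t y
  define E where "E x t y = J2 y * F (x - y, t) + 2 * (J1 y * F1 (x - y, t)) + J y * F2 (x - y, t)" for x t y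
  have shift: "(x - y, t) + u *\<^sub>R (- v, 0) = (x - (y + u *\<^sub>R v), t)" for x y :: "real \<times> real" and t u :: real
    by simp
  have dJ: "((\<lambda>u. f (y + u *\<^sub>R v)) has_real_derivative g (y + \<tau> *\<^sub>R v)) (at \<tau> within I)"
    if "has_line_deriv UNIV v f g" "\<tau> \<in> I" for f g y \<tau> I
    by (rule has_line_derivD[OF that(1) _ that(2)]) simp
  have dF: "((\<lambda>u. f (x - (y + u *\<^sub>R v), t)) has_real_derivative g (x - (y + \<tau> *\<^sub>R v), t)) (at \<tau> within I)"
    if "has_line_deriv (UNIV \<times> {0..T}) (- v, 0) f g" "\<tau> \<in> I" "t \<in> {0..T}" for f g x y t \<tau> I
    using has_line_derivD[OF that(1), of I "(x - y, t)" \<tau>] that unfolding shift by simp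
  \<comment> \<open>Compactness is taken in the variables \<open>(x, t, y)\<close>. The difference
    \<open>x - y\<close> may leave the box, but \<open>F\<close> is continuous for all space
    arguments.\<close>
  let ?B = "cbox (0, 0) (L1, L2) \<times> {0..T} \<times> cbox (0, 0) (L1, L2)"
  have cJ: "continuous_on ?B (\<lambda>p. f (snd (snd p)))" if "continuous_on UNIV f" for f :: "real \<times> real \<Rightarrow> real"
    by (rule continuous_on_compose2[OF that]) (auto intro!: continuous_intros)
  have cF: "continuous_on ?B (\<lambda>p. f (fst p - snd (snd p), fst (snd p)))"
    if "continuous_on (UNIV \<times> {0..T}) f" for f :: "(real \<times> real) \<times> real \<Rightarrow> real"
    by (rule continuous_on_compose2[OF that]) (auto intro!: continuous_intros)
  have "compact ?B" by (intro compact_Times compact_cbox compact_Icc)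
  moreover have "continuous_on ?B (\<lambda>p. E (fst p) (fst (snd p)) (snd (snd p)))"
    unfolding E_def by (intro continuous_intros cJ cF J0 J1 F0 F1)
  ultimately obtain K where K: "0 \<le> K" "\<And>p. p \<in> ?B \<Longrightarrow> \<bar>E (fst p) (fst (snd p)) (snd (snd p))\<bar> \<le> K"
    by (rule continuous_on_compact_bound) blast
  show thesis
  proof (rule that[of K D E])
    show "((\<lambda>u. J (y + u *\<^sub>R v) * F (x - (y + u *\<^sub>R v), t)) has_real_derivative D x t (y + \<tau> *\<^sub>R v)) (at \<tau> within I)"
      if "t \<in> {0..T}" "\<tau> \<in> I" for x t y \<tau> I
      using DERIV_mult[OF dJ[OF J1(3) that(2)] dF[OF F1(3) that(2,1)]] unfolding D_def by (simp add: algebra_simps)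
    show "((\<lambda>u. D x t (y + u *\<^sub>R v)) has_real_derivative E x t (y + \<tau> *\<^sub>R v)) (at \<tau> within I)"
      if "t \<in> {0..T}" "\<tau> \<in> I" for x t y \<tau> I
      unfolding D_def
      by (rule DERIV_cong[OF DERIV_add[OF DERIV_mult[OF dJ[OF J1(4) that(2)] dF[OF F1(3) that(2,1)]]
          DERIV_mult[OF dJ[OF J1(3) that(2)] dF[OF F1(4) that(2,1)]]]]) (simp add: E_def)
    show "\<bar>E x t y\<bar> \<le> K" if "x \<in> cbox (0, 0) (L1, L2)" "t \<in> {0..T}" "y \<in> cbox (0, 0) (L1, L2)" for x t y
      using K(2)[of "(x, t, y)"] that by simp
  qed (rule K)
qed

lemma integral_Omega:
  fixes f :: "real \<times> real \<Rightarrow> real"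
  shows "integral (Omega L1 L2) f = integral (cbox (0, 0) (L1, L2)) f"
proof -
  have "Omega L1 L2 = box (0, 0) (L1, L2)"
    by (force simp: Omega_def box_def Basis_prod_def)
  then show ?thesis by (simp add: integral_open_interval)
qed

lemma grid_point_in_Icc:
  assumes "0 < h" "i \<in> {1..int m}"
  shows "grid_point h (of_int i) \<in> {0..real m * h}"
proof -
  have "real_of_int i \<ge> 1" "real_of_int i \<le> real m" using assms(2) by auto
  then show ?thesis using assms(1) by (auto simp: grid_point_def intro!: mult_right_mono)
qed

text \<open>The half-cell offsets cancel: the kernel is sampled at \<open>(k * h, l * h)\<close> and
  the grid function at the node minus exactly that point. Hence the discrete convolution is the
  rectangle rule for the periodic integrand of the continuous one.\<close>

lemma grid_conv_error:
  fixes J :: "real \<times> real \<Rightarrow> real" and \<Phi> :: "real \<times> real \<Rightarrow> real \<Rightarrow> real"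
  assumes J: "smooth_per L1 L2 J" and F: "smooth_on (UNIV \<times> {0..T}) (\<lambda>(x, t). \<Phi> x t)"
    and per: "\<And>t. t \<in> {0..T} \<Longrightarrow> periodic_fun2 L1 L2 (\<lambda>x. \<Phi> x t)"
  obtains C where "0 \<le> C"
    "\<And>h m n t i j. \<lbrakk>0 < h; L1 = real m * h; L2 = real n * h; t \<in> {0..T}; i \<in> {1..int m}; j \<in> {1..int n}\<rbrakk> \<Longrightarrow>
      \<bar>grid_conv h m n (vertex_restrict h J) (cell_restrict h (\<lambda>x. \<Phi> x t)) i j
        - per_conv L1 L2 J (\<lambda>x. \<Phi> x t) (grid_point h (of_int i), grid_point h (of_int j))\<bar> \<le> C * h\<^sup>2"
proof -
  have J': "smooth_on UNIV J" and perJ: "\<And>x. J (x + (L1, 0)) = J x" "\<And>x. J (x + (0, L2)) = J x"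
    using J by (auto simp: smooth_per_def periodic_fun2_def)
  have perF: "\<Phi> (x + (L1, 0)) t = \<Phi> x t" "\<Phi> (x + (0, L2)) t = \<Phi> x t" if "t \<in> {0..T}" for x t
    using per[OF that] unfolding periodic_fun2_def by blast+
  obtain D1 D11 and K1 where K1: "0 \<le> K1"
    "\<And>x t y \<tau> I. t \<in> {0..T} \<Longrightarrow> \<tau> \<in> I \<Longrightarrow>
       ((\<lambda>u. J (y + u *\<^sub>R (1, 0)) * \<Phi> (x - (y + u *\<^sub>R (1, 0))) t) has_real_derivative D1 x t (y + \<tau> *\<^sub>R (1, 0))) (at \<tau> within I)"
    "\<And>x t y \<tau> I. t \<in> {0..T} \<Longrightarrow> \<tau> \<in> I \<Longrightarrow>
       ((\<lambda>u. D1 x t (y + u *\<^sub>R (1, 0))) has_real_derivative D11 x t (y + \<tau> *\<^sub>R (1, 0))) (at \<tau> within I)"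
    "\<And>x t y. x \<in> cbox (0, 0) (L1, L2) \<Longrightarrow> t \<in> {0..T} \<Longrightarrow> y \<in> cbox (0, 0) (L1, L2) \<Longrightarrow> \<bar>D11 x t y\<bar> \<le> K1"
    by (rule conv_integrand_line[OF J' F, where v = "(1, 0)"]) (unfold prod.case, rule that)
  obtain D2 D22 and K2 where K2: "0 \<le> K2"
    "\<And>x t y \<tau> I. t \<in> {0..T} \<Longrightarrow> \<tau> \<in> I \<Longrightarrow>
       ((\<lambda>u. J (y + u *\<^sub>R (0, 1)) * \<Phi> (x - (y + u *\<^sub>R (0, 1))) t) has_real_derivative D2 x t (y + \<tau> *\<^sub>R (0, 1))) (at \<tau> within I)"
    "\<And>x t y \<tau> I. t \<in> {0..T} \<Longrightarrow> \<tau> \<in> I \<Longrightarrow>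
       ((\<lambda>u. D2 x t (y + u *\<^sub>R (0, 1))) has_real_derivative D22 x t (y + \<tau> *\<^sub>R (0, 1))) (at \<tau> within I)"
    "\<And>x t y. x \<in> cbox (0, 0) (L1, L2) \<Longrightarrow> t \<in> {0..T} \<Longrightarrow> y \<in> cbox (0, 0) (L1, L2) \<Longrightarrow> \<bar>D22 x t y\<bar> \<le> K2"
    by (rule conv_integrand_line[OF J' F, where v = "(0, 1)"]) (unfold prod.case, rule that)
  define K where "K = max K1 K2"
  show thesis
  \<comment> \<open>Absolute values, because the signs of \<open>L1\<close> and \<open>L2\<close>
    become known only once a grid with \<open>L1 = real m * h\<close> and
    \<open>L2 = real n * h\<close> is given.\<close>
  proof (rule that[of "2 * K * \<bar>L1\<bar> * \<bar>L2\<bar>"])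
    show "0 \<le> 2 * K * \<bar>L1\<bar> * \<bar>L2\<bar>" using K1(1) by (simp add: K_def)
    fix h t :: real and m n :: nat and i j :: int
    assume h: "0 < h" and L1: "L1 = real m * h" and L2: "L2 = real n * h" and t: "t \<in> {0..T}"
      and i: "i \<in> {1..int m}" and j: "j \<in> {1..int n}"
    define x where "x = (grid_point h (of_int i), grid_point h (of_int j))"
    define G where "G y = J y * \<Phi> (x - y) t" for y
    have x: "x \<in> cbox (0, 0) (L1, L2)"
      using grid_point_in_Icc[OF h i] grid_point_in_Icc[OF h j] by (simp add: x_def L1 L2)
    have cont: "continuous_on (cbox (0, 0) (L1, L2)) G"
    proof -
      have "continuous_on UNIV J" "continuous_on (UNIV \<times> {0..T}) (\<lambda>(x, t). \<Phi> x t)"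
        using J' F unfolding smooth_on_def by (blast intro: Ck_on_imp_continuous_on)+
      moreover have "continuous_on UNIV (\<lambda>y. (\<lambda>(x, t). \<Phi> x t) (x - y, t))"
        by (rule continuous_on_compose2[OF calculation(2)]) (use t in \<open>auto intro!: continuous_intros\<close>)
      ultimately have "continuous_on UNIV G" unfolding G_def by (auto intro: continuous_intros)
      then show ?thesis by (rule continuous_on_subset) simp
    qed
    have "\<bar>integral (cbox (0, 0) (L1, L2)) G
      - h\<^sup>2 * (\<Sum>k=1..int m. \<Sum>l=1..int n. G (of_int k * h, of_int l * h))\<bar> \<le> 2 * K * L1 * L2 * h\<^sup>2"
    proof (rule rectangle_rule_periodic_2d[OF h L1 L2 cont, where ?D1.0 = "D1 x t" and ?D11.0 = "D11 x t"
          and ?D2.0 = "D2 x t" and ?D22.0 = "D22 x t"])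
      show "G (L1, b) = G (0, b)" for b
        unfolding G_def using perJ(1)[of "(0, b)"] perF(1)[OF t, of "x - (L1, b)"] by (cases x) simp
      show "G (a, L2) = G (a, 0)" for a
        unfolding G_def using perJ(2)[of "(a, 0)"] perF(2)[OF t, of "x - (a, L2)"] by (cases x) simp
      fix a b assume a: "a \<in> {0..L1}" and b: "b \<in> {0..L2}"
      show "((\<lambda>a. G (a, b)) has_real_derivative D1 x t (a, b)) (at a within {0..L1})"
        unfolding G_def using K1(2)[OF t a, of "(0, b)" x] by simp
      show "((\<lambda>a. D1 x t (a, b)) has_real_derivative D11 x t (a, b)) (at a within {0..L1})"
        using K1(3)[OF t a, of x "(0, b)"] by simp
      show "((\<lambda>b. G (a, b)) has_real_derivative D2 x t (a, b)) (at b within {0..L2})"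
        unfolding G_def using K2(2)[OF t b, of "(a, 0)" x] by simp
      show "((\<lambda>b. D2 x t (a, b)) has_real_derivative D22 x t (a, b)) (at b within {0..L2})"
        using K2(3)[OF t b, of x "(a, 0)"] by simp
      show "\<bar>D11 x t (a, b)\<bar> \<le> K" "\<bar>D22 x t (a, b)\<bar> \<le> K"
        using K1(4)[OF x t, of "(a, b)"] K2(4)[OF x t, of "(a, b)"] a b by (auto simp: K_def)
    qed
    moreover have "per_conv L1 L2 J (\<lambda>x. \<Phi> x t) x = integral (cbox (0, 0) (L1, L2)) G"
      unfolding per_conv_def integral_Omega G_def ..
    moreover have "grid_conv h m n (vertex_restrict h J) (cell_restrict h (\<lambda>x. \<Phi> x t)) i j
        = h\<^sup>2 * (\<Sum>k=1..int m. \<Sum>l=1..int n. G (of_int k * h, of_int l * h))"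
      unfolding grid_conv_def G_def x_def
      by (simp add: vertex_restrict_def cell_restrict_def grid_point_def algebra_simps)
    moreover have "0 \<le> L1" "0 \<le> L2" using h L1 L2 by auto
    ultimately show "\<bar>grid_conv h m n (vertex_restrict h J) (cell_restrict h (\<lambda>x. \<Phi> x t)) i j
        - per_conv L1 L2 J (\<lambda>x. \<Phi> x t) (grid_point h (of_int i), grid_point h (of_int j))\<bar>
        \<le> 2 * K * \<bar>L1\<bar> * \<bar>L2\<bar> * h\<^sup>2"
      by (simp add: x_def abs_minus_commute)
  qed
qed

section \<open>Regularity in time\<close>

text \<open>One constant for all estimates in time that the consistency proof uses: the size of the
  solution, its Lipschitz bound (for the cubic term), its second differences (for the extrapolation)
  and the trapezoidal rule. The last is stated for any time derivative \<open>f'\<close>, so that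
  the right-hand side of the equation can be inserted.\<close>

lemma slab_time_estimates:
  fixes \<Phi> :: "real \<times> real \<Rightarrow> real \<Rightarrow> real"
  assumes T: "0 < T" and F: "smooth_on (UNIV \<times> {0..T}) (\<lambda>(x, t). \<Phi> x t)" and X: "compact X"
  obtains K where "0 \<le> K"
    "\<And>x t. x \<in> X \<Longrightarrow> t \<in> {0..T} \<Longrightarrow> \<bar>\<Phi> x t\<bar> \<le> K"
    "\<And>x t s. x \<in> X \<Longrightarrow> 0 \<le> s \<Longrightarrow> 0 \<le> t \<Longrightarrow> t + s \<le> T \<Longrightarrow> \<bar>\<Phi> x (t + s) - \<Phi> x t\<bar> \<le> K * s"
    "\<And>x t s. x \<in> X \<Longrightarrow> 0 \<le> s \<Longrightarrow> 0 \<le> t - s \<Longrightarrow> t + s \<le> T \<Longrightarrow>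
       \<bar>\<Phi> x (t + s) - 2 * \<Phi> x t + \<Phi> x (t - s)\<bar> \<le> K * s\<^sup>2"
    "\<And>x t s f'. x \<in> X \<Longrightarrow> 0 \<le> s \<Longrightarrow> 0 \<le> t \<Longrightarrow> t + s \<le> T \<Longrightarrow>
       (\<And>t. t \<in> {0..T} \<Longrightarrow> (\<Phi> x has_real_derivative f' t) (at t within {0..T})) \<Longrightarrow>
       \<bar>\<Phi> x (t + s) - \<Phi> x t - s / 2 * (f' t + f' (t + s))\<bar> \<le> K * s ^ 3"
proof -
  obtain g1 g2 g3 where g: "continuous_on (UNIV \<times> {0..T}) g1" "continuous_on (UNIV \<times> {0..T}) g2"
    "continuous_on (UNIV \<times> {0..T}) g3"
    "has_line_deriv (UNIV \<times> {0..T}) ((0, 0), 1) (\<lambda>(x, t). \<Phi> x t) g1"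
    "has_line_deriv (UNIV \<times> {0..T}) ((0, 0), 1) g1 g2" "has_line_deriv (UNIV \<times> {0..T}) ((0, 0), 1) g2 g3"
    by (rule smooth_on_line3[OF F])
  have g0: "continuous_on (UNIV \<times> {0..T}) (\<lambda>(x, t). \<Phi> x t)"
    using F unfolding smooth_on_def by (blast intro: Ck_on_imp_continuous_on)
  have line: "((\<lambda>t. f (x, t)) has_real_derivative f' (x, t)) (at t within I)"
    if "has_line_deriv (UNIV \<times> {0..T}) ((0, 0), 1) f f'" "I \<subseteq> {0..T}" "t \<in> I"
    for f f' :: "(real \<times> real) \<times> real \<Rightarrow> real" and x t I
  proof -
    have shift: "(x, 0) + u *\<^sub>R ((0, 0), 1) = (x, u)" for u by (cases x) simp
    show ?thesis
      by (rule has_line_derivD[OF that(1) _ that(3), of "(x, 0)", unfolded shift]) (use that(2) in auto)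
  qed
  have bound: "\<exists>K\<ge>0. \<forall>x\<in>X. \<forall>t\<in>{0..T}. \<bar>f (x, t)\<bar> \<le> K"
    if "continuous_on (UNIV \<times> {0..T}) f" for f :: "(real \<times> real) \<times> real \<Rightarrow> real"
  proof -
    have "compact (X \<times> {0..T})" by (intro compact_Times X compact_Icc)
    moreover have "continuous_on (X \<times> {0..T}) f" by (rule continuous_on_subset[OF that]) auto
    ultimately obtain K where "0 \<le> K" "\<And>p. p \<in> X \<times> {0..T} \<Longrightarrow> \<bar>f p\<bar> \<le> K"
      by (rule continuous_on_compact_bound) blast
    then show ?thesis by blast
  qed
  obtain K0 where K0: "0 \<le> K0" "\<And>x t. x \<in> X \<Longrightarrow> t \<in> {0..T} \<Longrightarrow> \<bar>\<Phi> x t\<bar> \<le> K0"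
    using bound[OF g0] by auto
  obtain K1 where K1: "0 \<le> K1" "\<And>x t. x \<in> X \<Longrightarrow> t \<in> {0..T} \<Longrightarrow> \<bar>g1 (x, t)\<bar> \<le> K1"
    using bound[OF g(1)] by auto
  obtain K2 where K2: "0 \<le> K2" "\<And>x t. x \<in> X \<Longrightarrow> t \<in> {0..T} \<Longrightarrow> \<bar>g2 (x, t)\<bar> \<le> K2"
    using bound[OF g(2)] by auto
  obtain K3 where K3: "0 \<le> K3" "\<And>x t. x \<in> X \<Longrightarrow> t \<in> {0..T} \<Longrightarrow> \<bar>g3 (x, t)\<bar> \<le> K3"
    using bound[OF g(3)] by auto
  have d0: "(\<Phi> x has_real_derivative g1 (x, t)) (at t within I)" if "I \<subseteq> {0..T}" "t \<in> I" for x t I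
    using line[OF g(4) that] by simp
  define K where "K = K0 + K1 + 2 * K2 + K3"
  have K: "0 \<le> K" "K0 \<le> K" "K1 \<le> K" "2 * K2 \<le> K" "K3 \<le> K"
    using K0(1) K1(1) K2(1) K3(1) by (auto simp: K_def)
  show thesis
  proof (rule that[OF K(1)])
    show "\<bar>\<Phi> x t\<bar> \<le> K" if "x \<in> X" "t \<in> {0..T}" for x t
      using K0(2)[OF that] K(2) by simp
    show "\<bar>\<Phi> x (t + s) - \<Phi> x t\<bar> \<le> K * s" if "x \<in> X" "0 \<le> s" "0 \<le> t" "t + s \<le> T" for x t s
    proof -
      have "\<bar>\<Phi> x (t + s) - \<Phi> x t\<bar> \<le> K1 * \<bar>t + s - t\<bar>"
        by (rule derivative_bound_imp_Lipschitz[of 0 T _ "\<lambda>t. g1 (x, t)"]) (use that d0 K1(2) in auto)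
      also have "\<dots> \<le> K * s" using K(3) that by (simp add: mult_right_mono)
      finally show ?thesis .
    qed
    show "\<bar>\<Phi> x (t + s) - 2 * \<Phi> x t + \<Phi> x (t - s)\<bar> \<le> K * s\<^sup>2"
      if x: "x \<in> X" and s: "0 \<le> s" "0 \<le> t - s" "t + s \<le> T" for x t s
    proof -
      \<comment> \<open>The second difference is the increment of the forward difference
        \<open>d\<close> over \<open>{t - s..t}\<close>; two mean value estimates give the two
        factors \<open>s\<close>.\<close>
      define d where "d \<tau> = \<Phi> x (\<tau> + s) - \<Phi> x \<tau>" for \<tau>
      have "(d has_real_derivative g1 (x, \<tau> + s) - g1 (x, \<tau>)) (at \<tau> within {t - s..t})" if \<tau>: "\<tau> \<in> {t - s..t}" for \<tau>
      proof -
        have "(\<Phi> x has_real_derivative g1 (x, \<tau> + s)) (at (\<tau> + s) within (\<lambda>\<tau>. \<tau> + s) ` {t - s..t})"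
          by (rule d0) (use s \<tau> in auto)
        moreover have "((\<lambda>\<tau>. \<tau> + s) has_real_derivative 1) (at \<tau> within {t - s..t})"
          by (auto intro!: derivative_eq_intros)
        ultimately have "((\<lambda>\<tau>. \<Phi> x (\<tau> + s)) has_real_derivative g1 (x, \<tau> + s)) (at \<tau> within {t - s..t})"
          using DERIV_image_chain[of "\<Phi> x" "g1 (x, \<tau> + s)" "\<lambda>\<tau>. \<tau> + s" \<tau> "{t - s..t}" 1]
          by (simp add: o_def)
        then show ?thesis
          unfolding d_def by (rule DERIV_diff) (rule d0, use s \<tau> in auto)
      qed
      moreover have "\<bar>g1 (x, \<tau> + s) - g1 (x, \<tau>)\<bar> \<le> K2 * s" if "\<tau> \<in> {t - s..t}" for \<tau>
        using derivative_bound_imp_Lipschitz[of 0 T "\<lambda>t. g1 (x, t)" "\<lambda>t. g2 (x, t)" K2 \<tau> "\<tau> + s"]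
          line[OF g(5), of "{0..T}"] K2(2)[OF x] that s by auto
      ultimately have "\<bar>d t - d (t - s)\<bar> \<le> K2 * s * \<bar>t - (t - s)\<bar>"
        by (rule derivative_bound_imp_Lipschitz) (use s in auto)
      also have "\<dots> \<le> K * s\<^sup>2" using K(4) K2(1) s by (simp add: power2_eq_square mult.assoc mult_right_mono)
      finally show ?thesis by (simp add: d_def algebra_simps)
    qed
    show "\<bar>\<Phi> x (t + s) - \<Phi> x t - s / 2 * (f' t + f' (t + s))\<bar> \<le> K * s ^ 3"
      if x: "x \<in> X" and s: "0 \<le> s" "0 \<le> t" "t + s \<le> T"
        and f': "\<And>t. t \<in> {0..T} \<Longrightarrow> (\<Phi> x has_real_derivative f' t) (at t within {0..T})" for x t s f'
    proof -
      \<comment> \<open>One-sided derivatives at the end points are unique because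
        \<open>{0..T}\<close> is non-degenerate; this identifies \<open>f'\<close> with the smooth
        derivative \<open>g1\<close>.\<close>
      have f'_eq: "f' t = g1 (x, t)" if "t \<in> {0..T}" for t
        using vector_derivative_unique_within_closed_interval[OF T, of t "\<Phi> x" "f' t" "g1 (x, t)"]
          f'[OF that] d0[OF _ that] that by (simp add: has_real_derivative_iff_has_vector_derivative)
      have sub: "{t..t + s} \<subseteq> {0..T}" using s by auto
      have "\<bar>\<Phi> x (t + s) - \<Phi> x t - (t + s - t) / 2 * (g1 (x, t) + g1 (x, t + s))\<bar> \<le> K3 * (t + s - t) ^ 3"
        by (rule trapezoid_antiderivative[OF _ d0[OF sub] line[OF g(5) sub] line[OF g(6) sub] K3(2)[OF x]])
           (use s sub in auto)
      also have "\<dots> \<le> K * s ^ 3" using K(5) s by (simp add: mult_right_mono)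
      finally show ?thesis using f'_eq s by simp
    qed
  qed
qed

section \<open>Periodic grid functions\<close>

lemma periodic_fun2_shift:
  assumes "periodic_fun2 L1 L2 f"
  shows "f (x + (of_int a * L1, of_int b * L2)) = f x"
proof -
  have *: "g (y + of_int c * p) = g y" if g: "\<And>y. g (y + p) = g y" for g :: "real \<Rightarrow> real" and y p and c :: int
  proof (induction c arbitrary: y rule: int_induct[of _ 0])
    case (step1 c)
    then show ?case using g[of "y + of_int c * p"] by (simp add: algebra_simps)
  next
    case (step2 c)
    then show ?case using g[of "y + of_int (c - 1) * p"] by (simp add: algebra_simps)
  qed simp
  have "f (x1 + L1, x2) = f (x1, x2)" "f (x1, x2 + L2) = f (x1, x2)" for x1 x2
    using assms by (auto simp: periodic_fun2_def)
  then show ?thesis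
    using *[of "\<lambda>z. f (z, snd x + of_int b * L2)" L1 "fst x" a] *[of "\<lambda>z. f (fst x, z)" L2 "snd x" b]
    by (cases x) simp
qed

lemma grid_periodic_cell_restrict:
  assumes "periodic_fun2 (real m * h) (real n * h) f"
  shows "grid_periodic m n (cell_restrict h f)"
  unfolding grid_periodic_def
proof (intro allI)
  fix i j a b
  show "cell_restrict h f (i + a * int m) (j + b * int n) = cell_restrict h f i j"
    using periodic_fun2_shift[OF assms, of "(grid_point h (of_int i), grid_point h (of_int j))" a b]
    by (simp add: cell_restrict_def grid_point_def algebra_simps)
qed

text \<open>The representative is fixed before the grid function, so several periodic grid
  functions, and in particular an error, can be moved to the fundamental cell at once. Since indices
  start at 1, the remainder is taken after subtracting 1.\<close>

lemma grid_periodic_fundamental_cell: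
  assumes "0 < m" "0 < n"
  obtains i' j' where "i' \<in> {1..int m}" "j' \<in> {1..int n}"
    "\<And>\<phi>. grid_periodic m n \<phi> \<Longrightarrow> \<phi> i j = \<phi> i' j'"
proof
  show "(i - 1) mod int m + 1 \<in> {1..int m}" "(j - 1) mod int n + 1 \<in> {1..int n}"
    using assms by (auto simp: add1_zle_eq)
  fix \<phi> assume "grid_periodic m n \<phi>"
  then have "\<phi> ((i - 1) mod int m + 1 + (i - 1) div int m * int m)
      ((j - 1) mod int n + 1 + (j - 1) div int n * int n) = \<phi> ((i - 1) mod int m + 1) ((j - 1) mod int n + 1)"
    unfolding grid_periodic_def by blast
  then show "\<phi> i j = \<phi> ((i - 1) mod int m + 1) ((j - 1) mod int n + 1)"
    by (simp add: algebra_simps)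
qed

lemma grid_conv_linear:
  "grid_conv h m n f (\<lambda>i j. a * \<phi> i j + b * \<psi> i j) i j = a * grid_conv h m n f \<phi> i j + b * grid_conv h m n f \<psi> i j"
  by (simp add: grid_conv_def sum.distrib sum_distrib_left algebra_simps)

lemma grid_conv_diff:
  "grid_conv h m n f (\<lambda>i j. \<phi> i j - \<psi> i j) i j = grid_conv h m n f \<phi> i j - grid_conv h m n f \<psi> i j"
  by (simp add: grid_conv_def sum_subtractf algebra_simps)

text \<open>There are \<open>m * n\<close> terms, each weighted by \<open>h\<^sup>2\<close>, so the
  sum of the weights is the area of the domain and does not grow under refinement.\<close>

lemma grid_conv_bound:
  assumes "\<And>k l. k \<in> {1..int m} \<Longrightarrow> l \<in> {1..int n} \<Longrightarrow> \<bar>f k l\<bar> \<le> A" and "\<And>i j. \<bar>\<phi> i j\<bar> \<le> B"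
  shows "\<bar>grid_conv h m n f \<phi> i j\<bar> \<le> (real m * h) * (real n * h) * A * B"
proof -
  have "\<bar>\<Sum>k=1..int m. \<Sum>l=1..int n. f k l * \<phi> (i - k) (j - l)\<bar> \<le> (\<Sum>k=1..int m. \<Sum>l=1..int n. A * B)"
  proof (intro order_trans[OF sum_abs] sum_mono)
    fix k l assume kl: "k \<in> {1..int m}" "l \<in> {1..int n}"
    have "0 \<le> A" using assms(1)[OF kl] by linarith
    then show "\<bar>f k l * \<phi> (i - k) (j - l)\<bar> \<le> A * B"
      unfolding abs_mult by (intro mult_mono assms kl) auto
  qed
  then have "\<bar>grid_conv h m n f \<phi> i j\<bar> \<le> h\<^sup>2 * (\<Sum>k=1..int m. \<Sum>l=1..int n. A * B)"
    unfolding grid_conv_def abs_mult by (simp add: mult_left_mono)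
  then show ?thesis by (simp add: power2_eq_square mult_ac)
qed

section \<open>Stability and consistency of one step\<close>

text \<open>The difference quotient of \<open>eta\<close> in its second argument is a sum of
  squares; this is the monotonicity behind stability of the implicit cubic term.\<close>

lemma eta_diff_right:
  obtains d where "0 \<le> d" "eta a B - eta a b = d * (B - b)"
proof
  show "0 \<le> ((a + B)\<^sup>2 + (a + b)\<^sup>2 + (B + b)\<^sup>2) / 8" by simp
  show "eta a B - eta a b = ((a + B)\<^sup>2 + (a + b)\<^sup>2 + (B + b)\<^sup>2) / 8 * (B - b)"
    by (simp add: eta_def power2_eq_square field_simps)
qed

text \<open>The difference quotient in the first argument is a quarter of six monomials, each at
  most \<open>R\<^sup>2\<close> in modulus.\<close>

lemma eta_diff_left:
  assumes "\<bar>A\<bar> \<le> R" "\<bar>a\<bar> \<le> R" "\<bar>B\<bar> \<le> R"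
  shows "\<bar>eta A B - eta a B\<bar> \<le> 3 / 2 * R\<^sup>2 * \<bar>A - a\<bar>"
proof -
  have R: "x * y \<le> R\<^sup>2" "- (R\<^sup>2) \<le> x * y" if "\<bar>x\<bar> \<le> R" "\<bar>y\<bar> \<le> R" for x y
  proof -
    have "\<bar>x * y\<bar> \<le> R\<^sup>2" unfolding abs_mult power2_eq_square using that by (intro mult_mono) auto
    then show "x * y \<le> R\<^sup>2" "- (R\<^sup>2) \<le> x * y" by simp_all
  qed
  define q where "q = (A * A + A * a + a * a + B * A + B * a + B * B) / 4"
  have "A * A + A * a + a * a + B * A + B * a + B * B \<le> R\<^sup>2 + R\<^sup>2 + R\<^sup>2 + R\<^sup>2 + R\<^sup>2 + R\<^sup>2"
    by (intro add_mono R(1) assms)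
  moreover have "- (R\<^sup>2) + - (R\<^sup>2) + - (R\<^sup>2) + - (R\<^sup>2) + - (R\<^sup>2) + - (R\<^sup>2)
      \<le> A * A + A * a + a * a + B * A + B * a + B * B"
    by (intro add_mono R(2) assms)
  ultimately have "\<bar>q\<bar> \<le> 3 / 2 * R\<^sup>2" by (simp add: q_def)
  moreover have "eta A B - eta a B = q * (A - a)"
    by (simp add: eta_def q_def power2_eq_square field_simps)
  ultimately show ?thesis by (metis abs_mult abs_ge_zero mult_right_mono)
qed

text \<open>The new iterate enters only through nondecreasing terms, so those can be moved to the left-hand side
  and dropped: neither an a priori bound on \<open>b\<close> nor a restriction on \<open>\<mu>\<close> is needed.\<close>

lemma scheme_step_stability:
  assumes num: "b - a = - \<mu> * (eta a b + \<alpha> * (1/2 * (a + b)) - \<beta> * (3/2 * a - 1/2 * p) - V)"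
    and ex: "B - A = - \<mu> * (eta A B + \<alpha> * (1/2 * (A + B)) - \<beta> * (3/2 * A - 1/2 * P) - W) + \<tau>"
    and "0 \<le> \<mu>" "0 \<le> \<alpha>" "0 \<le> \<beta>"
    and R: "\<bar>A\<bar> \<le> R" "\<bar>a\<bar> \<le> R" "\<bar>B\<bar> \<le> R"
    and E: "\<bar>A - a\<bar> \<le> E" "\<bar>P - p\<bar> \<le> E" and W: "\<bar>W - V\<bar> \<le> Q * E"
  shows "\<bar>B - b\<bar> \<le> (1 + \<mu> * (3/2 * R\<^sup>2 + \<alpha> + 2 * \<beta> + Q)) * E + \<bar>\<tau>\<bar>"
proof -
  obtain d where d: "0 \<le> d" "eta a B - eta a b = d * (B - b)" by (rule eta_diff_right)
  \<comment> \<open>The coefficient that the implicit terms contribute to \<open>B - b\<close>; all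
    contributions of old errors are collected in \<open>\<rho>\<close>.\<close>
  define \<kappa> where "\<kappa> = \<mu> * d + \<mu> * \<alpha> / 2"
  define \<rho> where "\<rho> = - (eta A B - eta a B) - \<alpha> / 2 * (A - a) + \<beta> * (3/2 * (A - a) - 1/2 * (P - p)) + (W - V)"
  have \<kappa>: "0 \<le> \<kappa>" using assms(3,4) d(1) by (simp add: \<kappa>_def)
  have "B - b = (A - a) + (B - A) - (b - a)" by simp
  also have "\<dots> = (A - a) - \<mu> * (eta a B - eta a b) - \<mu> * \<alpha> / 2 * (B - b) + \<mu> * \<rho> + \<tau>"
    unfolding num ex \<rho>_def by (simp add: algebra_simps add_divide_distrib diff_divide_distrib)
  finally have "(1 + \<kappa>) * (B - b) = (A - a) + \<mu> * \<rho> + \<tau>"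
    unfolding d(2) \<kappa>_def by (simp add: algebra_simps)
  then have "(1 + \<kappa>) * \<bar>B - b\<bar> = \<bar>(A - a) + \<mu> * \<rho> + \<tau>\<bar>"
    using \<kappa> by (metis abs_mult abs_of_nonneg add_nonneg_nonneg zero_le_one)
  moreover have "\<bar>B - b\<bar> \<le> (1 + \<kappa>) * \<bar>B - b\<bar>"
    using \<kappa> mult_right_mono[of 1 "1 + \<kappa>" "\<bar>B - b\<bar>"] by simp
  ultimately have "\<bar>B - b\<bar> \<le> \<bar>A - a\<bar> + \<bar>\<mu> * \<rho>\<bar> + \<bar>\<tau>\<bar>" by linarith
  also have "\<bar>\<mu> * \<rho>\<bar> \<le> \<mu> * ((3/2 * R\<^sup>2 + \<alpha> + 2 * \<beta> + Q) * E)"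
  proof -
    have "\<bar>eta A B - eta a B\<bar> \<le> 3 / 2 * R\<^sup>2 * \<bar>A - a\<bar>" by (rule eta_diff_left[OF R])
    also have "\<dots> \<le> 3 / 2 * R\<^sup>2 * E" by (intro mult_left_mono E) simp
    finally have 1: "\<bar>eta A B - eta a B\<bar> \<le> 3 / 2 * R\<^sup>2 * E" .
    have "\<bar>\<alpha> / 2 * (A - a)\<bar> = \<alpha> * (\<bar>A - a\<bar> / 2)" using assms(4) by (simp add: abs_mult)
    also have "\<dots> \<le> \<alpha> * E" using E(1) assms(4) by (intro mult_left_mono) auto
    finally have 2: "\<bar>\<alpha> / 2 * (A - a)\<bar> \<le> \<alpha> * E" .
    have "\<bar>3/2 * (A - a) - 1/2 * (P - p)\<bar> \<le> 2 * E"
      using E by (simp add: field_simps abs_le_iff)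
    then have 3: "\<bar>\<beta> * (3/2 * (A - a) - 1/2 * (P - p))\<bar> \<le> \<beta> * (2 * E)"
      using assms(5) unfolding abs_mult by (simp add: mult_left_mono)
    have "\<bar>- x - y + z + w\<bar> \<le> \<bar>x\<bar> + \<bar>y\<bar> + \<bar>z\<bar> + \<bar>w\<bar>" for x y z w :: real by linarith
    from order_trans[OF this add_mono[OF add_mono[OF add_mono[OF 1 2] 3] W]]
    have "\<bar>\<rho>\<bar> \<le> 3/2 * R\<^sup>2 * E + \<alpha> * E + \<beta> * (2 * E) + Q * E" unfolding \<rho>_def .
    also have "\<dots> = (3/2 * R\<^sup>2 + \<alpha> + 2 * \<beta> + Q) * E" by (simp add: algebra_simps)
    finally have "\<bar>\<rho>\<bar> \<le> \<dots>" .
    then show ?thesis using assms(3) by (simp add: abs_mult mult_left_mono)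
  qed
  finally show ?thesis using E(1) by (simp add: ring_distribs)
qed

text \<open>The exact values are inserted into the scheme and compared with the trapezoidal rule for
  the equation. What remains is the cubic defect \<open>(A - B)\<^sup>2 * (A + B) / 4\<close>, the
  quadrature errors of the convolutions, and the gap \<open>A - 1/2 * P - 1/2 * B\<close> between
  the extrapolated and the averaged value. \<open>W0\<close> is the intermediate quantity: the
  discrete convolution of the averaged value.\<close>

lemma scheme_step_consistency:
  assumes trap: "\<bar>B - A - s / 2 * (- M * (A ^ 3 + \<gamma>c * A - \<gamma>e * A + (Ic - Ie) * A - GA)
        + - M * (B ^ 3 + \<gamma>c * B - \<gamma>e * B + (Ic - Ie) * B - GB))\<bar> \<le> K * s ^ 3"
    and "0 \<le> s" "0 \<le> M" "0 \<le> ce + \<gamma>e"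
    and R: "\<bar>A\<bar> \<le> R" "\<bar>B\<bar> \<le> R" and AB: "\<bar>B - A\<bar> \<le> K * s"
    and cc: "\<bar>cc - Ic\<bar> \<le> C * h\<^sup>2" and ce: "\<bar>ce - Ie\<bar> \<le> C * h\<^sup>2"
    and W0: "\<bar>W0 - (GA + GB) / 2\<bar> \<le> C * h\<^sup>2" and W: "\<bar>W - W0\<bar> \<le> Q * \<Delta>"
    and \<Delta>: "\<bar>A - 1/2 * P - 1/2 * B\<bar> \<le> \<Delta>"
  shows "\<bar>B - A + M * s * (eta A B + (cc + \<gamma>c) * (1/2 * (A + B)) - (ce + \<gamma>e) * (3/2 * A - 1/2 * P) - W)\<bar>
    \<le> s * (K * s\<^sup>2 + M * (R * K\<^sup>2 / 2 * s\<^sup>2 + (2 * R + 1) * C * h\<^sup>2 + (ce + \<gamma>e + Q) * \<Delta>))"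
proof -
  define \<delta> where "\<delta> = A - 1/2 * P - 1/2 * B"
  define \<rho> where "\<rho> = - ((A - B)\<^sup>2 * (A + B) / 4) + (cc - Ic) * ((A + B) / 2) - (ce - Ie) * ((A + B) / 2)
    - (ce + \<gamma>e) * \<delta> - (W - W0) - (W0 - (GA + GB) / 2)"
  have C0: "0 \<le> C * h\<^sup>2" using cc by linarith
  have half: "\<bar>(A + B) / 2\<bar> \<le> R" using R by (auto simp: abs_le_iff)
  have "(A - B)\<^sup>2 \<le> (K * s)\<^sup>2"
    using AB by (metis abs_ge_zero abs_minus_commute power2_abs power_mono)
  then have "\<bar>(A - B)\<^sup>2 * ((A + B) / 2)\<bar> \<le> (K * s)\<^sup>2 * R"
    unfolding abs_mult using half by (intro mult_mono) auto
  then have 1: "\<bar>(A - B)\<^sup>2 * (A + B) / 4\<bar> \<le> R * K\<^sup>2 / 2 * s\<^sup>2"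
    by (simp add: power_mult_distrib abs_mult mult_ac)
  have 2: "\<bar>(cc - Ic) * ((A + B) / 2)\<bar> \<le> C * h\<^sup>2 * R"
    unfolding abs_mult by (intro mult_mono cc half C0) auto
  have 3: "\<bar>(ce - Ie) * ((A + B) / 2)\<bar> \<le> C * h\<^sup>2 * R"
    unfolding abs_mult by (intro mult_mono ce half C0) auto
  have 4: "\<bar>(ce + \<gamma>e) * \<delta>\<bar> \<le> (ce + \<gamma>e) * \<Delta>"
    unfolding abs_mult using \<Delta> assms(4) by (simp add: \<delta>_def mult_left_mono)
  have "\<bar>\<rho>\<bar> \<le> R * K\<^sup>2 / 2 * s\<^sup>2 + C * h\<^sup>2 * R + C * h\<^sup>2 * R + (ce + \<gamma>e) * \<Delta> + Q * \<Delta> + C * h\<^sup>2"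
    using 1 2 3 4 W W0 unfolding \<rho>_def by linarith
  also have "\<dots> = R * K\<^sup>2 / 2 * s\<^sup>2 + (2 * R + 1) * C * h\<^sup>2 + (ce + \<gamma>e + Q) * \<Delta>"
    by (simp add: algebra_simps)
  finally have \<rho>: "\<bar>M * s * \<rho>\<bar> \<le> M * s * (R * K\<^sup>2 / 2 * s\<^sup>2 + (2 * R + 1) * C * h\<^sup>2 + (ce + \<gamma>e + Q) * \<Delta>)"
    using assms(2,3) by (simp add: abs_mult mult_left_mono)
  have "B - A + M * s * (eta A B + (cc + \<gamma>c) * (1/2 * (A + B)) - (ce + \<gamma>e) * (3/2 * A - 1/2 * P) - W)
      = (B - A - s / 2 * (- M * (A ^ 3 + \<gamma>c * A - \<gamma>e * A + (Ic - Ie) * A - GA)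
        + - M * (B ^ 3 + \<gamma>c * B - \<gamma>e * B + (Ic - Ie) * B - GB))) + M * s * \<rho>"
    unfolding \<rho>_def \<delta>_def eta_def by (simp add: field_simps power2_eq_square power3_eq_cube)
  then show ?thesis using trap \<rho> by (simp add: algebra_simps power2_eq_square power3_eq_cube)
qed

text \<open>Stability plus consistency, with \<open>\<Lambda>\<close> and \<open>D\<close> chosen
  before the grid, the time step and the step number. The requirement \<open>E \<le> 1\<close>
  bounds the old iterate by the size of the solution plus 1. Errors are measured at all integer
  indices, since the convolution reaches outside the fundamental cell.\<close>

lemma nAC_scheme_step_error:
  fixes \<Phi> :: "real \<times> real \<Rightarrow> real \<Rightarrow> real"
  assumes L: "0 < L1" "0 < L2" and M: "0 \<le> M" and \<gamma>: "0 \<le> \<gamma>c" "0 \<le> \<gamma>e"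
    and kernel: "kernel_assms L1 L2 Jc Je" and T: "0 < T"
    and sol: "nAC_solution L1 L2 M Jc Je \<gamma>c \<gamma>e T \<Phi>0 \<Phi>"
  obtains \<Lambda> D where "0 \<le> \<Lambda>" "0 \<le> D"
    "\<And>s h m n \<phi> k E i j. \<lbrakk>0 < s; 0 < h; 0 < m; 0 < n; L1 = real m * h; L2 = real n * h;
      nAC_scheme s h m n M Jc Je \<gamma>c \<gamma>e (cell_restrict h (\<lambda>x. \<Phi> x 0)) \<phi>; real (Suc k) * s \<le> T; E \<le> 1;
      \<And>i j. \<bar>cell_restrict h (\<lambda>x. \<Phi> x (real k * s)) i j - \<phi> k i j\<bar> \<le> E;
      \<And>i j. \<bar>cell_restrict h (\<lambda>x. \<Phi> x (real (k - 1) * s)) i j - \<phi> (k - 1) i j\<bar> \<le> E\<rbrakk> \<Longrightarrow>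
      \<bar>cell_restrict h (\<lambda>x. \<Phi> x (real (Suc k) * s)) i j - \<phi> (Suc k) i j\<bar>
        \<le> (1 + \<Lambda> * s) * E + D * s * (h\<^sup>2 + s\<^sup>2 + (if k = 0 then s else 0))"
proof -
  define J where "J = (\<lambda>x. Jc x - Je x)"
  define Ic where "Ic = integral (Omega L1 L2) Jc"
  define Ie where "Ie = integral (Omega L1 L2) Je"
  let ?X = "cbox (0, 0) (L1, L2) :: (real \<times> real) set"
  have Jc: "smooth_per L1 L2 Jc" and Je: "smooth_per L1 L2 Je" and pos: "\<And>x. 0 \<le> Jc x" "\<And>x. 0 \<le> Je x"
    using kernel by (auto simp: kernel_assms_def)
  then have J: "smooth_per L1 L2 J"
    unfolding smooth_per_def smooth_on_def periodic_fun2_def J_def by (metis Ck_on_diff)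
  have cont: "continuous_on A f" if "smooth_per L1 L2 f" for f A
    using that continuous_on_subset[OF _ subset_UNIV] unfolding smooth_per_def smooth_on_def
    by (metis Ck_on_imp_continuous_on)
  have per_conv_one: "per_conv L1 L2 J (\<lambda>_. 1) x = Ic - Ie" for x
    unfolding per_conv_def J_def Ic_def Ie_def integral_Omega mult_1_right
    by (intro Henstock_Kurzweil_Integration.integral_diff integrable_continuous cont Jc Je)
  have slab: "smooth_on (UNIV \<times> {0..T}) (\<lambda>(x, t). \<Phi> x t)"
    and per: "\<And>t. t \<in> {0..T} \<Longrightarrow> periodic_fun2 L1 L2 (\<lambda>x. \<Phi> x t)"
    using sol unfolding nAC_solution_def by blast+
  define N where "N x t = - M * ((\<Phi> x t) ^ 3 + \<gamma>c * \<Phi> x t - \<gamma>e * \<Phi> x t + (Ic - Ie) * \<Phi> x t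
      - per_conv L1 L2 J (\<lambda>y. \<Phi> y t) x)" for x t
  have ode: "(\<Phi> x has_real_derivative N x t) (at t within {0..T})" if "t \<in> {0..T}" for x t
    using sol that unfolding nAC_solution_def N_def per_conv_one[symmetric, of x] J_def by blast
  \<comment> \<open>The coefficients obtained by convolving the kernels with 1 are covered by the
    same quadrature estimate, applied to a constant in place of the solution.\<close>
  have one: "smooth_on (UNIV \<times> {0..T}) (\<lambda>(x, t). 1)" "periodic_fun2 L1 L2 (\<lambda>_. 1)"
    by (simp_all add: smooth_on_def case_prod_unfold Ck_on_const periodic_fun2_def)
  have cell_one: "cell_restrict h (\<lambda>_. 1) = (\<lambda>_ _. 1)" for h
    by (simp add: cell_restrict_def fun_eq_iff)
  obtain C1 where C1: "0 \<le> C1"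
    "\<And>h m n t i j. \<lbrakk>0 < h; L1 = real m * h; L2 = real n * h; t \<in> {0..T}; i \<in> {1..int m}; j \<in> {1..int n}\<rbrakk> \<Longrightarrow>
      \<bar>grid_conv h m n (vertex_restrict h Jc) (\<lambda>_ _. 1) i j - Ic\<bar> \<le> C1 * h\<^sup>2"
    using grid_conv_error[OF Jc one] unfolding cell_one by (auto simp: per_conv_def Ic_def)
  obtain C2 where C2: "0 \<le> C2"
    "\<And>h m n t i j. \<lbrakk>0 < h; L1 = real m * h; L2 = real n * h; t \<in> {0..T}; i \<in> {1..int m}; j \<in> {1..int n}\<rbrakk> \<Longrightarrow>
      \<bar>grid_conv h m n (vertex_restrict h Je) (\<lambda>_ _. 1) i j - Ie\<bar> \<le> C2 * h\<^sup>2"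
    using grid_conv_error[OF Je one] unfolding cell_one by (auto simp: per_conv_def Ie_def)
  obtain C3 where C3: "0 \<le> C3"
    "\<And>h m n t i j. \<lbrakk>0 < h; L1 = real m * h; L2 = real n * h; t \<in> {0..T}; i \<in> {1..int m}; j \<in> {1..int n}\<rbrakk> \<Longrightarrow>
      \<bar>grid_conv h m n (vertex_restrict h J) (cell_restrict h (\<lambda>x. \<Phi> x t)) i j
        - per_conv L1 L2 J (\<lambda>x. \<Phi> x t) (grid_point h (of_int i), grid_point h (of_int j))\<bar> \<le> C3 * h\<^sup>2"
    using grid_conv_error[OF J slab per] by blast
  define C where "C = C1 + C2 + C3"
  have C: "C1 * h\<^sup>2 \<le> C * h\<^sup>2" "C2 * h\<^sup>2 \<le> C * h\<^sup>2" "C3 * h\<^sup>2 \<le> C * h\<^sup>2" "0 \<le> C" for h :: real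
    using C1(1) C2(1) C3(1) by (auto simp: C_def intro!: mult_right_mono)
  obtain K where K: "0 \<le> K"
    "\<And>x t. x \<in> ?X \<Longrightarrow> t \<in> {0..T} \<Longrightarrow> \<bar>\<Phi> x t\<bar> \<le> K"
    "\<And>x t s. x \<in> ?X \<Longrightarrow> 0 \<le> s \<Longrightarrow> 0 \<le> t \<Longrightarrow> t + s \<le> T \<Longrightarrow> \<bar>\<Phi> x (t + s) - \<Phi> x t\<bar> \<le> K * s"
    "\<And>x t s. x \<in> ?X \<Longrightarrow> 0 \<le> s \<Longrightarrow> 0 \<le> t - s \<Longrightarrow> t + s \<le> T \<Longrightarrow>
       \<bar>\<Phi> x (t + s) - 2 * \<Phi> x t + \<Phi> x (t - s)\<bar> \<le> K * s\<^sup>2"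
    "\<And>x t s f'. x \<in> ?X \<Longrightarrow> 0 \<le> s \<Longrightarrow> 0 \<le> t \<Longrightarrow> t + s \<le> T \<Longrightarrow>
       (\<And>t. t \<in> {0..T} \<Longrightarrow> (\<Phi> x has_real_derivative f' t) (at t within {0..T})) \<Longrightarrow>
       \<bar>\<Phi> x (t + s) - \<Phi> x t - s / 2 * (f' t + f' (t + s))\<bar> \<le> K * s ^ 3"
    using slab_time_estimates[OF T slab compact_cbox[of "(0, 0)" "(L1, L2)"]] by blast
  obtain A where A: "0 \<le> A" "\<And>x. x \<in> ?X \<Longrightarrow> \<bar>Jc x\<bar> + \<bar>Je x\<bar> \<le> A"
  proof (rule continuous_on_compact_bound[of ?X "\<lambda>x. \<bar>Jc x\<bar> + \<bar>Je x\<bar>"])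
    show "continuous_on ?X (\<lambda>x. \<bar>Jc x\<bar> + \<bar>Je x\<bar>)" by (intro continuous_intros cont Jc Je)
  qed auto
  \<comment> \<open>\<open>Q\<close> bounds the discrete convolution with each of \<open>Jc\<close>,
    \<open>Je\<close> and \<open>J\<close> as an operator in the maximum norm; \<open>R\<close>
    below bounds both the exact values and the old iterate.\<close>
  define Q where "Q = L1 * L2 * A"
  have Q: "0 \<le> Q" using L A(1) by (simp add: Q_def)
  define R where "R = K + 1"
  define \<Lambda> where "\<Lambda> = M * (3/2 * R\<^sup>2 + (Q + \<gamma>c) + 2 * (Q + \<gamma>e) + 2 * Q)"
  define D where "D = K + M * (R * K\<^sup>2 / 2 + (2 * R + 1) * C + (Q + \<gamma>e + Q) * K)"
  show thesis
  proof (rule that[of \<Lambda> D])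
    show "0 \<le> \<Lambda>" unfolding \<Lambda>_def using M \<gamma> Q by simp
    show "0 \<le> D" unfolding D_def using M \<gamma> Q K(1) C(4) by (simp add: R_def)
    fix s h :: real and m n k :: nat and \<phi> :: "nat \<Rightarrow> grid_fun" and E :: real and i0 j0 :: int
    assume s: "0 < s" and h: "0 < h" and mn: "0 < m" "0 < n" and L1: "L1 = real m * h" and L2: "L2 = real n * h"
      and scheme: "nAC_scheme s h m n M Jc Je \<gamma>c \<gamma>e (cell_restrict h (\<lambda>x. \<Phi> x 0)) \<phi>"
      and k: "real (Suc k) * s \<le> T" and E: "E \<le> 1"
      and Ek: "\<And>i j. \<bar>cell_restrict h (\<lambda>x. \<Phi> x (real k * s)) i j - \<phi> k i j\<bar> \<le> E"
      and Ek1: "\<And>i j. \<bar>cell_restrict h (\<lambda>x. \<Phi> x (real (k - 1) * s)) i j - \<phi> (k - 1) i j\<bar> \<le> E"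
    define u where "u l = cell_restrict h (\<lambda>x. \<Phi> x (real l * s))" for l
    \<comment> \<open>In the first step the extrapolation is the constant one, so its gap to the
      averaged value is of order \<open>s\<close> rather than \<open>s\<^sup>2\<close>;
      \<open>\<iota>\<close> records this loss.\<close>
    define \<iota> where "\<iota> = (if k = 0 then s else 0)"
    define \<Delta> where "\<Delta> = K * (s\<^sup>2 + \<iota>)"
    define cc where "cc = grid_conv h m n (vertex_restrict h Jc) (\<lambda>_ _. 1)"
    define ce where "ce = grid_conv h m n (vertex_restrict h Je) (\<lambda>_ _. 1)"
    have tk: "real k * s + s = real (Suc k) * s" by (simp add: algebra_simps)
    have time: "real l * s \<in> {0..T}" if "l \<le> Suc k" for l
    proof -
      have "real l * s \<le> real (Suc k) * s" using that s by (intro mult_right_mono) auto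
      from order_trans[OF this k] show ?thesis using s by simp
    qed
    have u_per: "grid_periodic m n (u l)" if "l \<le> Suc k" for l
      unfolding u_def using per[OF time[OF that]] by (intro grid_periodic_cell_restrict) (simp add: L1 L2)
    have node: "(grid_point h (of_int i), grid_point h (of_int j)) \<in> ?X" if "i \<in> {1..int m}" "j \<in> {1..int n}" for i j
      using grid_point_in_Icc[OF h that(1)] grid_point_in_Icc[OF h that(2)] by (simp add: L1 L2)
    have vertex: "(of_int p * h, of_int q * h) \<in> ?X" if "p \<in> {1..int m}" "q \<in> {1..int n}" for p q
    proof -
      have "real_of_int p \<le> real m" "real_of_int q \<le> real n" using that by auto
      then show ?thesis using that h by (simp add: L1 L2 mult_right_mono)
    qed
    have vertex_bound: "\<bar>vertex_restrict h Jc p q\<bar> \<le> A" "\<bar>vertex_restrict h Je p q\<bar> \<le> A"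
      "\<bar>vertex_restrict h J p q\<bar> \<le> A" if "p \<in> {1..int m}" "q \<in> {1..int n}" for p q
      using A(2)[OF vertex[OF that]] by (auto simp: vertex_restrict_def grid_point_def J_def)
    \<comment> \<open>The convolution samples this gap at arbitrary indices, whereas the time
      estimates hold on a compact set; periodicity of \<open>u\<close> bridges the two.\<close>
    have \<delta>: "\<bar>u k i j - 1/2 * u (k - 1) i j - 1/2 * u (Suc k) i j\<bar> \<le> \<Delta>" for i j
    proof -
      obtain i' j' where ij: "i' \<in> {1..int m}" "j' \<in> {1..int n}"
        "\<And>\<phi>. grid_periodic m n \<phi> \<Longrightarrow> \<phi> i j = \<phi> i' j'"
        by (rule grid_periodic_fundamental_cell[OF mn, of i j]) blast
      define x where "x = (grid_point h (of_int i'), grid_point h (of_int j'))"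
      have x: "x \<in> ?X" unfolding x_def by (rule node[OF ij(1,2)])
      have ux: "u l i j = \<Phi> x (real l * s)" if "l \<le> Suc k" for l
        unfolding ij(3)[OF u_per[OF that]] by (simp add: u_def x_def cell_restrict_def)
      have "\<bar>a - 1/2 * p - 1/2 * b\<bar> = \<bar>b - 2 * a + p\<bar> / 2" for a b p :: real
        by (simp add: abs_if field_simps)
      then have "\<bar>u k i j - 1/2 * u (k - 1) i j - 1/2 * u (Suc k) i j\<bar>
          = \<bar>\<Phi> x (real k * s + s) - 2 * \<Phi> x (real k * s) + \<Phi> x (real (k - 1) * s)\<bar> / 2"
        by (simp add: ux tk del: of_nat_Suc)
      also have "\<dots> \<le> \<Delta>"
      proof (cases "k = 0")
        case True
        then have "\<bar>\<Phi> x s - \<Phi> x 0\<bar> \<le> K * s"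
          using K(3)[OF x, of s 0] s k by simp
        moreover have "0 \<le> K * s\<^sup>2" using K(1) by simp
        ultimately show ?thesis using True by (simp add: \<Delta>_def \<iota>_def algebra_simps)
      next
        case False
        then have "real (k - 1) * s = real k * s - s" by (simp add: of_nat_diff algebra_simps)
        moreover have "0 \<le> real k * s - s" using False s by (simp add: algebra_simps)
        ultimately have "\<bar>\<Phi> x (real k * s + s) - 2 * \<Phi> x (real k * s) + \<Phi> x (real (k - 1) * s)\<bar> \<le> K * s\<^sup>2"
          using K(4)[OF x, of s "real k * s"] s k tk by simp
        then show ?thesis using False by (simp add: \<Delta>_def \<iota>_def)
      qed
      finally show ?thesis .
    qed
    have conv_bound: "\<bar>grid_conv h m n (vertex_restrict h J) \<psi> i j\<bar> \<le> Q * B"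
      if "\<And>i j. \<bar>\<psi> i j\<bar> \<le> B" for \<psi> B i j
      using grid_conv_bound[of m n "vertex_restrict h J" A \<psi> B h i j] vertex_bound(3) that
      by (simp add: Q_def L1 L2)
    have cc_bounds: "0 \<le> cc i j" "cc i j \<le> Q" and ce_bounds: "0 \<le> ce i j" "ce i j \<le> Q" for i j
    proof -
      show "0 \<le> cc i j" "0 \<le> ce i j"
        unfolding cc_def ce_def grid_conv_def vertex_restrict_def
        using pos by (intro mult_nonneg_nonneg sum_nonneg; simp)+
      show "cc i j \<le> Q" "ce i j \<le> Q"
        using grid_conv_bound[of m n "vertex_restrict h Jc" A "\<lambda>_ _. 1" 1 h i j]
          grid_conv_bound[of m n "vertex_restrict h Je" A "\<lambda>_ _. 1" 1 h i j] vertex_bound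
        by (auto simp: Q_def L1 L2 cc_def ce_def)
    qed
    have cell: "\<bar>u (Suc k) i j - \<phi> (Suc k) i j\<bar> \<le> (1 + \<Lambda> * s) * E + D * s * (h\<^sup>2 + s\<^sup>2 + \<iota>)"
      if ij: "i \<in> {1..int m}" "j \<in> {1..int n}" for i j
    proof -
      define x where "x = (grid_point h (of_int i), grid_point h (of_int j))"
      have x: "x \<in> ?X" unfolding x_def by (rule node[OF ij])
      have ux: "u l i j = \<Phi> x (real l * s)" for l by (simp add: u_def x_def cell_restrict_def)
      define a b p where "a = \<phi> k i j" and "b = \<phi> (Suc k) i j" and "p = \<phi> (k - 1) i j"
      define A' B P where "A' = u k i j" and "B = u (Suc k) i j" and "P = u (k - 1) i j"
      define V where "V = grid_conv h m n (vertex_restrict h J) (\<lambda>i j. 3/2 * \<phi> k i j - 1/2 * \<phi> (k - 1) i j) i j"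
      define W where "W = grid_conv h m n (vertex_restrict h J) (\<lambda>i j. 3/2 * u k i j - 1/2 * u (k - 1) i j) i j"
      define W0 where "W0 = grid_conv h m n (vertex_restrict h J) (\<lambda>i j. 1/2 * u k i j + 1/2 * u (Suc k) i j) i j"
      define GA GB where "GA = per_conv L1 L2 J (\<lambda>y. \<Phi> y (real k * s)) x"
        and "GB = per_conv L1 L2 J (\<lambda>y. \<Phi> y (real (Suc k) * s)) x"
      \<comment> \<open>\<open>\<tau>\<close> is by definition the residual of the exact solution in
        the scheme, so that the perturbed scheme equation required for stability holds
        trivially.\<close>
      define \<tau> where "\<tau> = B - A' + M * s * (eta A' B + (cc i j + \<gamma>c) * (1/2 * (A' + B))
        - (ce i j + \<gamma>e) * (3/2 * A' - 1/2 * P) - W)"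
      have R: "\<bar>A'\<bar> \<le> K" "\<bar>B\<bar> \<le> K"
        unfolding A'_def B_def ux by (intro K(2) x time; simp)+
      have "\<bar>\<tau>\<bar> \<le> s * (K * s\<^sup>2 + M * (R * K\<^sup>2 / 2 * s\<^sup>2 + (2 * R + 1) * C * h\<^sup>2 + (ce i j + \<gamma>e + Q) * \<Delta>))"
        unfolding \<tau>_def
      proof (rule scheme_step_consistency[where Ic = Ic and Ie = Ie and GA = GA and GB = GB and ?W0.0 = W0])
        show "\<bar>B - A' - s / 2 * (- M * (A' ^ 3 + \<gamma>c * A' - \<gamma>e * A' + (Ic - Ie) * A' - GA)
            + - M * (B ^ 3 + \<gamma>c * B - \<gamma>e * B + (Ic - Ie) * B - GB))\<bar> \<le> K * s ^ 3"
          using K(5)[OF x _ _ _ ode, of s "real k * s"] s k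
          unfolding tk N_def A'_def B_def ux GA_def GB_def by simp
        show "0 \<le> s" "0 \<le> M" "0 \<le> ce i j + \<gamma>e"
          using s M ce_bounds \<gamma> by (auto simp: add_nonneg_nonneg)
        show "\<bar>A'\<bar> \<le> R" "\<bar>B\<bar> \<le> R" using R by (simp_all add: R_def)
        show "\<bar>B - A'\<bar> \<le> K * s"
          using K(3)[OF x, of s "real k * s"] s k unfolding tk A'_def B_def ux by simp
        show "\<bar>cc i j - Ic\<bar> \<le> C * h\<^sup>2" "\<bar>ce i j - Ie\<bar> \<le> C * h\<^sup>2"
          using C1(2)[OF h L1 L2 time[of 0] ij] C2(2)[OF h L1 L2 time[of 0] ij] C(1,2)[of h]
          by (auto simp: cc_def ce_def)
        have "W0 = (grid_conv h m n (vertex_restrict h J) (u k) i j + grid_conv h m n (vertex_restrict h J) (u (Suc k)) i j) / 2"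
          unfolding W0_def grid_conv_linear by simp
        moreover have "\<bar>grid_conv h m n (vertex_restrict h J) (u k) i j - GA\<bar> \<le> C * h\<^sup>2"
          "\<bar>grid_conv h m n (vertex_restrict h J) (u (Suc k)) i j - GB\<bar> \<le> C * h\<^sup>2"
          using C3(2)[OF h L1 L2 time[of k] ij] C3(2)[OF h L1 L2 time[of "Suc k"] ij] C(3)[of h]
          unfolding u_def GA_def GB_def x_def by (auto simp del: of_nat_Suc)
        ultimately show "\<bar>W0 - (GA + GB) / 2\<bar> \<le> C * h\<^sup>2" by (simp add: field_simps abs_le_iff)
        have "W - W0 = grid_conv h m n (vertex_restrict h J)
            (\<lambda>i j. (3/2 * u k i j - 1/2 * u (k - 1) i j) - (1/2 * u k i j + 1/2 * u (Suc k) i j)) i j"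
          unfolding W_def W0_def by (rule grid_conv_diff[symmetric])
        also have "\<bar>\<dots>\<bar> \<le> Q * \<Delta>"
        proof (rule conv_bound)
          show "\<bar>(3/2 * u k i j - 1/2 * u (k - 1) i j) - (1/2 * u k i j + 1/2 * u (Suc k) i j)\<bar> \<le> \<Delta>" for i j
            using \<delta>[of i j] by (simp add: field_simps)
        qed
        finally show "\<bar>W - W0\<bar> \<le> Q * \<Delta>" .
        show "\<bar>A' - 1/2 * P - 1/2 * B\<bar> \<le> \<Delta>" unfolding A'_def B_def P_def by (rule \<delta>)
      qed
      also have "\<dots> \<le> s * (D * (h\<^sup>2 + s\<^sup>2 + \<iota>))"
      proof (intro mult_left_mono)
        define \<epsilon> where "\<epsilon> = h\<^sup>2 + s\<^sup>2 + \<iota>"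
        have \<iota>: "0 \<le> \<iota>" using s by (simp add: \<iota>_def)
        have \<epsilon>: "s\<^sup>2 \<le> \<epsilon>" "h\<^sup>2 \<le> \<epsilon>" "s\<^sup>2 + \<iota> \<le> \<epsilon>" using \<iota> by (auto simp: \<epsilon>_def)
        have "K * s\<^sup>2 + M * (R * K\<^sup>2 / 2 * s\<^sup>2 + (2 * R + 1) * C * h\<^sup>2 + (ce i j + \<gamma>e + Q) * (K * (s\<^sup>2 + \<iota>)))
          \<le> K * \<epsilon> + M * (R * K\<^sup>2 / 2 * \<epsilon> + (2 * R + 1) * C * \<epsilon> + (Q + \<gamma>e + Q) * (K * \<epsilon>))"
          using \<epsilon> \<iota> K(1) M C(4) Q \<gamma> ce_bounds[of i j]
          by (intro add_mono mult_left_mono mult_mono) (auto simp: R_def)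
        also have "\<dots> = D * \<epsilon>" by (simp add: D_def algebra_simps)
        finally show "K * s\<^sup>2 + M * (R * K\<^sup>2 / 2 * s\<^sup>2 + (2 * R + 1) * C * h\<^sup>2 + (ce i j + \<gamma>e + Q) * \<Delta>)
          \<le> D * (h\<^sup>2 + s\<^sup>2 + \<iota>)" by (simp add: \<Delta>_def \<epsilon>_def)
      qed (use s in simp)
      finally have \<tau>: "\<bar>\<tau>\<bar> \<le> D * s * (h\<^sup>2 + s\<^sup>2 + \<iota>)" by (simp add: mult_ac)
      have "\<bar>B - b\<bar> \<le> (1 + M * s * (3/2 * R\<^sup>2 + (cc i j + \<gamma>c) + 2 * (ce i j + \<gamma>e) + 2 * Q)) * E + \<bar>\<tau>\<bar>"
      proof (rule scheme_step_stability[where A = A' and a = a and P = P and p = p and V = V and W = W])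
        have vJ: "(\<lambda>k l. vertex_restrict h Jc k l - vertex_restrict h Je k l) = vertex_restrict h J"
          by (simp add: vertex_restrict_def J_def fun_eq_iff)
        have "\<phi> (Suc k) i j - \<phi> k i j = - M * s * chem_pot h m n (vertex_restrict h Jc) (vertex_restrict h Je) \<gamma>c \<gamma>e
            (\<phi> (k - 1)) (\<phi> k) (\<phi> (Suc k)) i j"
        proof -
          \<comment> \<open>Truncated subtraction gives \<open>0 - 1 = 0\<close>, which is exactly
            the convention for the value preceding the initial one.\<close>
          have "(if k = 0 then \<phi> 0 else \<phi> (k - 1)) = \<phi> (k - 1)" by simp
          moreover have "\<phi> (Suc k) i j - \<phi> k i j = - M * s * chem_pot h m n (vertex_restrict h Jc) (vertex_restrict h Je) \<gamma>c \<gamma>e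
              (if k = 0 then \<phi> 0 else \<phi> (k - 1)) (\<phi> k) (\<phi> (Suc k)) i j"
            using scheme unfolding nAC_scheme_def by blast
          ultimately show ?thesis by (simp only:)
        qed
        then show "b - a = - (M * s) * (eta a b + (cc i j + \<gamma>c) * (1/2 * (a + b)) - (ce i j + \<gamma>e) * (3/2 * a - 1/2 * p) - V)"
          unfolding chem_pot_def Let_def vJ a_def b_def p_def V_def cc_def ce_def by simp
        show "B - A' = - (M * s) * (eta A' B + (cc i j + \<gamma>c) * (1/2 * (A' + B)) - (ce i j + \<gamma>e) * (3/2 * A' - 1/2 * P) - W) + \<tau>"
          by (simp add: \<tau>_def)
        show "0 \<le> M * s" "0 \<le> cc i j + \<gamma>c" "0 \<le> ce i j + \<gamma>e"
          using M s \<gamma> cc_bounds ce_bounds by (auto simp: add_nonneg_nonneg)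
        show Aa: "\<bar>A' - a\<bar> \<le> E" and "\<bar>P - p\<bar> \<le> E"
          using Ek Ek1 by (simp_all add: A'_def a_def P_def p_def u_def)
        show "\<bar>A'\<bar> \<le> R" "\<bar>a\<bar> \<le> R" "\<bar>B\<bar> \<le> R" using R E Aa by (auto simp: R_def)
        have "W - V = grid_conv h m n (vertex_restrict h J)
            (\<lambda>i j. (3/2 * u k i j - 1/2 * u (k - 1) i j) - (3/2 * \<phi> k i j - 1/2 * \<phi> (k - 1) i j)) i j"
          unfolding W_def V_def by (rule grid_conv_diff[symmetric])
        \<comment> \<open>The extrapolation weights \<open>3/2\<close> and \<open>1/2\<close> add up
          to 2 in modulus.\<close>
        also have "\<bar>\<dots>\<bar> \<le> Q * (2 * E)"
        proof (rule conv_bound)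
          show "\<bar>(3/2 * u k i j - 1/2 * u (k - 1) i j) - (3/2 * \<phi> k i j - 1/2 * \<phi> (k - 1) i j)\<bar> \<le> 2 * E" for i j
            using Ek[of i j] Ek1[of i j] unfolding u_def by (simp add: field_simps abs_le_iff)
        qed
        finally show "\<bar>W - V\<bar> \<le> 2 * Q * E" by simp
      qed
      also have "\<dots> \<le> (1 + \<Lambda> * s) * E + \<bar>\<tau>\<bar>"
      proof -
        have "0 \<le> E" using Ek[of 0 0] by linarith
        moreover have "M * s * (3/2 * R\<^sup>2 + (cc i j + \<gamma>c) + 2 * (ce i j + \<gamma>e) + 2 * Q)
            \<le> M * s * (3/2 * R\<^sup>2 + (Q + \<gamma>c) + 2 * (Q + \<gamma>e) + 2 * Q)"
          using M s cc_bounds[of i j] ce_bounds[of i j] by (intro mult_left_mono) auto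
        then have "M * s * (3/2 * R\<^sup>2 + (cc i j + \<gamma>c) + 2 * (ce i j + \<gamma>e) + 2 * Q) \<le> \<Lambda> * s"
          by (simp add: \<Lambda>_def mult_ac)
        ultimately show ?thesis by (intro add_right_mono mult_right_mono) auto
      qed
      finally show ?thesis using \<tau> by (simp add: B_def b_def)
    qed
    have \<phi>_per: "grid_periodic m n (\<phi> (Suc k))" using scheme unfolding nAC_scheme_def by blast
    obtain i' j' where ij: "i' \<in> {1..int m}" "j' \<in> {1..int n}"
      "\<And>\<phi>. grid_periodic m n \<phi> \<Longrightarrow> \<phi> i0 j0 = \<phi> i' j'"
      by (rule grid_periodic_fundamental_cell[OF mn, of i0 j0]) blast
    show "\<bar>cell_restrict h (\<lambda>x. \<Phi> x (real (Suc k) * s)) i0 j0 - \<phi> (Suc k) i0 j0\<bar>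
        \<le> (1 + \<Lambda> * s) * E + D * s * (h\<^sup>2 + s\<^sup>2 + (if k = 0 then s else 0))"
      using cell[OF ij(1,2), folded ij(3)[OF u_per[OF order_refl]] ij(3)[OF \<phi>_per]] unfolding u_def \<iota>_def .
  qed
qed

section \<open>Convergence\<close>

text \<open>An explicit supersolution of the discrete Gronwall recursion, resting on
  \<open>1 + x \<le> exp x\<close>. The linear factor absorbs the source term and avoids division by
  \<open>\<Lambda>\<close>, which may be zero.\<close>

lemma exp_majorant_step:
  fixes D \<Lambda> s :: real
  assumes "0 \<le> D" "0 \<le> \<Lambda>" "0 \<le> s"
  defines "G \<equiv> \<lambda>k. D * (1 + real k * s) * exp (\<Lambda> * (real k * s))"
  shows "(1 + \<Lambda> * s) * G k + s * D \<le> G (Suc k)"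
proof -
  let ?e = "exp (\<Lambda> * (real (Suc k) * s))"
  have e: "?e = exp (\<Lambda> * (real k * s)) * exp (\<Lambda> * s)"
    by (simp add: exp_add[symmetric] algebra_simps)
  have "exp (\<Lambda> * (real k * s)) * (1 + \<Lambda> * s) \<le> ?e"
    unfolding e by (intro mult_left_mono exp_ge_add_one_self) simp
  then have "D * (1 + real k * s) * (exp (\<Lambda> * (real k * s)) * (1 + \<Lambda> * s)) \<le> D * (1 + real k * s) * ?e"
    using assms(1,3) by (intro mult_left_mono) auto
  moreover have "s * D * 1 \<le> s * D * ?e"
    using assms by (intro mult_left_mono) auto
  ultimately show ?thesis by (simp add: G_def algebra_simps)
qed

theorem theorem6p8:
  fixes L1 L2 M \<gamma>c \<gamma>e T Cstar :: real
    and Jc Je \<Phi>0 :: "real \<times> real \<Rightarrow> real"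
    and \<Phi> :: "real \<times> real \<Rightarrow> real \<Rightarrow> real"
  assumes "0 < L1" and "0 < L2"
    and "0 \<le> M"
    and "0 \<le> \<gamma>c" and "0 \<le> \<gamma>e"
    and "kernel_assms L1 L2 Jc Je"
    and "0 < \<gamma>c - \<gamma>e + integral (Omega L1 L2) (\<lambda>x. Jc x - Je x)"
    and "0 \<le> T"
    and "smooth_per L1 L2 \<Phi>0"
    and "nAC_solution L1 L2 M Jc Je \<gamma>c \<gamma>e T \<Phi>0 \<Phi>"
    and "\<And>\<Psi> x t. nAC_solution L1 L2 M Jc Je \<gamma>c \<gamma>e T \<Phi>0 \<Psi> \<Longrightarrow> t \<in> {0..T} \<Longrightarrow> \<Psi> x t = \<Phi> x t"
    and "0 < Cstar"
  shows "\<exists>s0>0. \<exists>h0>0. \<exists>C>0. \<forall>s h. \<forall>m n :: nat. \<forall>\<phi> :: nat \<Rightarrow> grid_fun.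
           0 < s \<and> s \<le> s0 \<and> 0 < h \<and> h \<le> h0 \<and> s \<le> Cstar * h \<and>
           0 < m \<and> 0 < n \<and> L1 = real m * h \<and> L2 = real n * h \<and>
           nAC_scheme s h m n M Jc Je \<gamma>c \<gamma>e (cell_restrict h (\<lambda>x. \<Phi> x 0)) \<phi> \<longrightarrow>
           (\<forall>l::nat. 0 < l \<and> real l * s \<le> T \<longrightarrow>
              grid_max_norm m n (\<lambda>i j. cell_restrict h (\<lambda>x. \<Phi> x (real l * s)) i j - \<phi> l i j)
                \<le> C * (h^2 + s^2))"
proof (cases "T = 0")
  \<comment> \<open>Vacuous: no positive multiple of \<open>s\<close> is at most 0. Excluding this
    case makes the time interval non-degenerate.\<close>
  case True
  then show ?thesis
    by (intro exI[of _ 1] conjI allI impI) (auto simp: mult_le_0_iff)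
next
  case False
  then have T: "0 < T" using assms(8) by simp
  obtain \<Lambda> D where \<Lambda>: "0 \<le> \<Lambda>" and D: "0 \<le> D" and
    step: "\<And>s h m n \<phi> k E i j. \<lbrakk>0 < s; 0 < h; 0 < m; 0 < n; L1 = real m * h; L2 = real n * h;
      nAC_scheme s h m n M Jc Je \<gamma>c \<gamma>e (cell_restrict h (\<lambda>x. \<Phi> x 0)) \<phi>; real (Suc k) * s \<le> T; E \<le> 1;
      \<And>i j. \<bar>cell_restrict h (\<lambda>x. \<Phi> x (real k * s)) i j - \<phi> k i j\<bar> \<le> E;
      \<And>i j. \<bar>cell_restrict h (\<lambda>x. \<Phi> x (real (k - 1) * s)) i j - \<phi> (k - 1) i j\<bar> \<le> E\<rbrakk> \<Longrightarrow>
      \<bar>cell_restrict h (\<lambda>x. \<Phi> x (real (Suc k) * s)) i j - \<phi> (Suc k) i j\<bar>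
        \<le> (1 + \<Lambda> * s) * E + D * s * (h\<^sup>2 + s\<^sup>2 + (if k = 0 then s else 0))"
    using nAC_scheme_step_error[OF assms(1-6) T assms(10)] by metis
  \<comment> \<open>The value at time \<open>T\<close> of the Gronwall majorant with source
    \<open>2 * D\<close>, plus 1 for positivity. With \<open>r = 1 / (2 * C)\<close> as threshold
    for both \<open>s\<close> and \<open>h\<close>, the final bound
    \<open>C * (h\<^sup>2 + s\<^sup>2)\<close> is at most 1.\<close>
  define C where "C = 2 * D * (1 + T) * exp (\<Lambda> * T) + 1"
  define r where "r = 1 / (2 * C)"
  have C: "1 \<le> C" unfolding C_def using D T by simp
  then have r: "0 < r" "r \<le> 1" by (auto simp: r_def field_simps)
  have main: "\<bar>cell_restrict h (\<lambda>x. \<Phi> x (real l * s)) i j - \<phi> l i j\<bar> \<le> C * (h\<^sup>2 + s\<^sup>2)"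
    if s: "0 < s" "s \<le> r" and h: "0 < h" "h \<le> r" and mn: "0 < m" "0 < n" "L1 = real m * h" "L2 = real n * h"
      and scheme: "nAC_scheme s h m n M Jc Je \<gamma>c \<gamma>e (cell_restrict h (\<lambda>x. \<Phi> x 0)) \<phi>"
      and l: "real l * s \<le> T" for s h m n \<phi> l i j
  proof -
    define \<epsilon> where "\<epsilon> = h\<^sup>2 + s\<^sup>2"
    \<comment> \<open>The majorant for the source \<open>2 * D * \<epsilon>\<close>; the factor 2
      leaves room for the less accurate first step.\<close>
    define G where "G k = 2 * D * \<epsilon> * (1 + real k * s) * exp (\<Lambda> * (real k * s))" for k
    have \<epsilon>: "0 \<le> \<epsilon>" by (simp add: \<epsilon>_def)
    have D\<epsilon>: "0 \<le> 2 * D * \<epsilon>" using D \<epsilon> by simp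
    have G_step: "(1 + \<Lambda> * s) * G k + s * (2 * D * \<epsilon>) \<le> G (Suc k)" for k
      using exp_majorant_step[OF D\<epsilon> \<Lambda> less_imp_le[OF s(1)]] unfolding G_def .
    have G0: "0 \<le> G k" for k unfolding G_def using D\<epsilon> s(1) by simp
    have G_le: "G k \<le> C * \<epsilon>" if "real k * s \<le> T" for k
    proof -
      have "G k \<le> 2 * D * \<epsilon> * (1 + T) * exp (\<Lambda> * T)"
        unfolding G_def using that D\<epsilon> \<Lambda> T s(1) by (intro mult_mono mult_left_mono) (auto intro: mult_left_mono)
      also have "\<dots> \<le> C * \<epsilon>" using \<epsilon> by (simp add: C_def algebra_simps)
      finally show ?thesis .
    qed
    have small: "C * \<epsilon> \<le> 1"
    proof -
      have "h\<^sup>2 \<le> r" "s\<^sup>2 \<le> r"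
        using h s r(2) mult_mono[of h r h 1] mult_mono[of s r s 1] by (auto simp: power2_eq_square)
      then have "C * \<epsilon> \<le> C * (2 * r)" unfolding \<epsilon>_def using C by (intro mult_left_mono) auto
      also have "\<dots> = 1" using C by (simp add: r_def)
      finally show ?thesis .
    qed
    \<comment> \<open>Complete induction, as each step of the scheme looks back at two earlier
      levels.\<close>
    have "\<forall>i j. \<bar>cell_restrict h (\<lambda>x. \<Phi> x (real k * s)) i j - \<phi> k i j\<bar> \<le> G k" if "real k * s \<le> T" for k
      using that
    proof (induction k rule: less_induct)
      case (less k)
      have init: "cell_restrict h (\<lambda>x. \<Phi> x 0) i j - \<phi> 0 i j = 0" for i j
        using scheme unfolding nAC_scheme_def by simp
      show ?case
      proof (cases k)
        case 0
        then show ?thesis using init G0[of 0] by simp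
      next
        case (Suc q)
        have before: "real p * s \<le> T" if "p \<le> q" for p
        proof -
          have "real p * s \<le> real k * s" using that s(1) Suc by (intro mult_right_mono) auto
          then show ?thesis using less.prems by linarith
        qed
        show ?thesis
        proof (cases "q = 0")
          \<comment> \<open>The initial error is exactly zero, so the first step can be run with
            \<open>E = 0\<close> and produces only its local error. There the extra \<open>s\<close>
            is multiplied by another \<open>s\<close>, and \<open>s \<le> 1\<close> bounds the whole
            by \<open>2 * D * \<epsilon>\<close>.\<close>
          case True
          have "\<bar>cell_restrict h (\<lambda>x. \<Phi> x (real (Suc q) * s)) i j - \<phi> (Suc q) i j\<bar>
              \<le> (1 + \<Lambda> * s) * 0 + D * s * (h\<^sup>2 + s\<^sup>2 + (if q = 0 then s else 0))" for i j
            by (rule step[OF s(1) h(1) mn scheme]) (use less.prems Suc True init in auto)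
          moreover have "D * s * (h\<^sup>2 + s\<^sup>2 + s) \<le> G (Suc q)"
          proof -
            have "s * (h\<^sup>2 + s\<^sup>2) \<le> 1 * (h\<^sup>2 + s\<^sup>2)"
              using s r(2) by (intro mult_right_mono) auto
            then have "s * (h\<^sup>2 + s\<^sup>2 + s) \<le> h\<^sup>2 + s\<^sup>2 + s\<^sup>2"
              by (simp add: power2_eq_square ring_distribs)
            also have "h\<^sup>2 + s\<^sup>2 + s\<^sup>2 \<le> 2 * \<epsilon>"
              by (simp add: \<epsilon>_def)
            finally have "D * (s * (h\<^sup>2 + s\<^sup>2 + s)) \<le> D * (2 * \<epsilon>)"
              using D by (rule mult_left_mono)
            also have "\<dots> \<le> 2 * D * \<epsilon> * ((1 + real (Suc q) * s) * exp (\<Lambda> * (real (Suc q) * s)))"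
            proof -
              have "1 * 1 \<le> (1 + real (Suc q) * s) * exp (\<Lambda> * (real (Suc q) * s))"
                using s(1) \<Lambda> by (intro mult_mono) auto
              from mult_left_mono[OF this D\<epsilon>] show ?thesis by simp
            qed
            finally show ?thesis by (simp add: G_def mult.assoc del: of_nat_Suc)
          qed
          ultimately show ?thesis using True Suc by (auto intro: order_trans)
        next
          case False
          \<comment> \<open>The step estimate takes a single \<open>E\<close> for both old levels;
            monotonicity of \<open>G\<close> allows \<open>G q\<close>.\<close>
          have IH: "\<bar>cell_restrict h (\<lambda>x. \<Phi> x (real p * s)) i j - \<phi> p i j\<bar> \<le> G q" if "p = q \<or> p = q - 1" for p i j
          proof -
            have "G (q - 1) \<le> G (Suc (q - 1))"
              using G_step[of "q - 1"] mult_nonneg_nonneg[OF mult_nonneg_nonneg[OF \<Lambda> less_imp_le[OF s(1)]] G0[of "q - 1"]]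
                mult_nonneg_nonneg[OF less_imp_le[OF s(1)] D\<epsilon>] by (simp add: algebra_simps)
            moreover have "\<bar>cell_restrict h (\<lambda>x. \<Phi> x (real p * s)) i j - \<phi> p i j\<bar> \<le> G p"
              using less.IH[of p] before[of p] that Suc by auto
            ultimately show ?thesis using that False by auto
          qed
          \<comment> \<open>This closes the bootstrap:
            \<open>G q \<le> C * \<epsilon> \<le> 1\<close> supplies the smallness of the old error
            that the step estimate demands.\<close>
          have "\<bar>cell_restrict h (\<lambda>x. \<Phi> x (real (Suc q) * s)) i j - \<phi> (Suc q) i j\<bar>
              \<le> (1 + \<Lambda> * s) * G q + D * s * (h\<^sup>2 + s\<^sup>2 + (if q = 0 then s else 0))" for i j
            by (rule step[OF s(1) h(1) mn scheme])
               (use less.prems Suc IH G_le[OF before[of q]] small in auto)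
          moreover have "D * s * \<epsilon> \<le> s * (2 * D * \<epsilon>)"
            using D s(1) \<epsilon> by simp
          then have "(1 + \<Lambda> * s) * G q + D * s * (h\<^sup>2 + s\<^sup>2) \<le> G (Suc q)"
            unfolding \<epsilon>_def[symmetric] using G_step[of q] by linarith
          ultimately show ?thesis using False Suc by (auto intro: order_trans)
        qed
      qed
    qed
    then show ?thesis using G_le[OF l] l unfolding \<epsilon>_def by (blast intro: order_trans)
  qed
  have "grid_max_norm m n \<psi> \<le> B" if "\<And>i j. \<bar>\<psi> i j\<bar> \<le> B" "0 < m" "0 < n" for m n \<psi> B
    unfolding grid_max_norm_def using that by (subst Max_le_iff) auto
  with main r(1) C show ?thesis
    by (intro exI[of _ r] conjI exI[of _ C]) auto
qed

end
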